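(* Let $\mathcal{C}$ be a Markov category with conditionals and let $(X_t)_{t\in[n]}$ and $(Y_t)_{t\in[n]}$ be two families of objects of $\mathcal{C}$. Then the following are equivalent for any state $p\colon I\to\bigotimes_{t\in[n]}(X_t\otimes Y_t)$: (i) The backward Markov property: (a) $X_t\perp X_{[t-2]},Y_{[t-1]}\mid X_{t-1}$ for all $t=1,\dots,n$, (b) $Y_t\perp Y_{[t-1]},X_{[t-1]}\mid X_t$ for all $t=1,\dots,n$. (ii) The local Markov property: (a) $X_t\perp X_{[t-2]},Y_{[t-1]}\mid X_{t-1}$ for all $t=1,\dots,n$, (b) $Y_t\perp X_{[n]\setminus\{t\}},Y_{[n]\setminus\{t\}}\mid X_t$ for all $t=0,\dots,n$. (iii) The global Markov property: for all disjoint sets $R,S,T\subseteq[n]$ and disjoint sets $U,V,W\subseteq[n]$ such that - for all $r\in R$, $t\in T$ there exists $s\in S$ such that $s$ is between $r$ and $t$ (that is, $r<s<t$ or $r>s>t$), and - for all $u\in U$, $w\in W$ there exists $s\in S$ such that $s$ is non-strictly between $u$ and $w$ (that is, $u\le s\le w$ or $u\ge s\ge w$), we have $X_R,Y_U\perp X_T,Y_W\mid X_S,Y_V$. (iv) There exist a state $f_0\colon I\to X_0$ and sequences of morphisms $f_t\colon X_{t-1}\to X_t$ and $g_t\colon X_t\to Y_t$ for $t=0,\dots,n$ (with the convention $X_{-1}:=I$) such that $$p=\Big(\bigotimes_{t=0}^n\big((\mathrm{id}_{X_t}\otimes g_t)\circ\mathrm{copy}_{X_t}\big)\Big)\circ m_n,$$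 where $m_0:=f_0$ and $m_t:=\big(\mathrm{id}_{X_0\otimes\cdots\otimes X_{t-2}}\otimes((\mathrm{id}_{X_{t-1}}\otimes f_t)\circ\mathrm{copy}_{X_{t-1}})\big)\circ m_{t-1}$ for $1\le t\le n$.
   Context: A Markov category is a symmetric monoidal category $\mathcal{C}$ whose monoidal unit $I$ is terminal, in which every object $X$ carries a distinguished commutative comonoid structure $\mathrm{copy}_X\colon X\to X\otimes X$, $\mathrm{del}_X\colon X\to I$, compatible with $\otimes$ (i.e. $\mathrm{copy}_{X\otimes Y}$ is $\mathrm{copy}_X\otimes\mathrm{copy}_Y$ followed by the swap of the middle factors, and similarly for $\mathrm{del}$). Coherence isomorphisms and symmetries (reorderings of tensor factors) are suppressed. A state is a morphism out of $I$. Marginals are obtained by composing with $\mathrm{del}$ on some output factors. $\mathcal{C}$ has conditionals if every $f\colon A\to X\otimes Y$ admits $f_{|X}\colon A\otimes X\to Y$ such that, with $f_X:=(\mathrm{id}_X\otimes\mathrm{del}_Y)\circ f$, one has $f=(\mathrm{id}_X\otimes f_{|X})\circ\sigma\circ(\mathrm{id}_A\otimes\mathrm{copy}_X)\circ(\mathrm{id}_A\otimes f_X)\circ\mathrm{copy}_A$, where $\sigma\colon A\otimes X\otimes X\to X\otimes A\otimes X$ is the evident permutation. Notation: $[n]=\{0,1,\dots,n\}$ (empty if $n<0$). For $R\subseteq[n]$, $X_R:=\bigotimes_{i\in R}X_i$, with $X_\emptyset=I$; similarly $Y_R$. Conditional independence: a state $p$ on a tensor product of objects displays $A\perp B\mid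 C$, where $A,B,C$ are tensor products of disjoint sets of its output factors, if its marginal $p_{ABC}$ on $A\otimes B\otimes C$ is of the form $p_{ABC}=(a\otimes b\otimes\mathrm{id}_C)\circ\mathrm{copy}^{(3)}_C\circ p_C$ for some morphisms $a\colon C\to A$, $b\colon C\to B$, where $\mathrm{copy}_C^{(3)}\colon C\to C\otimes C\otimes C$ is the threefold copy and $p_C$ is the marginal on $C$. All independences in the claim are to be displayed by $p$. A comma-separated list such as $X_R,Y_U$ denotes the tensor product $X_R\otimes Y_U$.
   Formalization: In (iii) two conditions are added: for all r∈R, w∈W some s∈S has r<s≤w or r>s≥w, and for all u∈U, t∈T some s∈S has u≤s<t or u≥s>t; without them n=0, R=W={0}, other sets empty would claim X_0 ⊥ Y_0, false for a correlated state. *)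

theory Defs
  imports Main
begin

section \<open>Markov categories\<close>

text \<open>
  Every value of type \<open>'o\<close> is an object and every value of type \<open>'m\<close> is a morphism;
  \<open>g \<cdot> f\<close> is meaningful when \<open>Cod f = Dom g\<close>. The monoidal structure is not assumed to be strict:
  \<open>assoc\<close>, \<open>lunit\<close>, \<open>runit\<close> are the coherence isomorphisms, and the primed fields their inverses.
\<close>

record ('o, 'm) markov_data =
  Dom :: "'m \<Rightarrow> 'o"
  Cod :: "'m \<Rightarrow> 'o"
  Id :: "'o \<Rightarrow> 'm"
  Comp :: "'m \<Rightarrow> 'm \<Rightarrow> 'm"  (infixr "\<cdot>\<index>" 60)
  unit_obj :: "'o"  ("\<I>\<index>")
  tensor :: "'o \<Rightarrow> 'o \<Rightarrow> 'o"  (infixr "\<otimes>\<index>" 70)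
  tensor_map :: "'m \<Rightarrow> 'm \<Rightarrow> 'm"  (infixr "\<boxtimes>\<index>" 70)
  assoc :: "'o \<Rightarrow> 'o \<Rightarrow> 'o \<Rightarrow> 'm"
  assoc' :: "'o \<Rightarrow> 'o \<Rightarrow> 'o \<Rightarrow> 'm"
  lunit :: "'o \<Rightarrow> 'm"
  lunit' :: "'o \<Rightarrow> 'm"
  runit :: "'o \<Rightarrow> 'm"
  runit' :: "'o \<Rightarrow> 'm"
  swap :: "'o \<Rightarrow> 'o \<Rightarrow> 'm"
  copy :: "'o \<Rightarrow> 'm"
  del :: "'o \<Rightarrow> 'm"

definition hom :: "('o, 'm, 'z) markov_data_scheme \<Rightarrow> 'o \<Rightarrow> 'o \<Rightarrow> 'm set" where
  "hom C A B = {f. Dom C f = A \<and> Cod C f = B}"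

locale category =
  fixes C :: "('o, 'm, 'z) markov_data_scheme" (structure)
  assumes Id_hom: "Id C A \<in> hom C A A"
    and Comp_hom: "\<lbrakk>f \<in> hom C A B; g \<in> hom C B D\<rbrakk> \<Longrightarrow> g \<cdot> f \<in> hom C A D"
    and Comp_Id: "f \<in> hom C A B \<Longrightarrow> f \<cdot> Id C A = f"
    and Id_Comp: "f \<in> hom C A B \<Longrightarrow> Id C B \<cdot> f = f"
    and Comp_assoc:
      "\<lbrakk>f \<in> hom C A B; g \<in> hom C B D; h \<in> hom C D E\<rbrakk> \<Longrightarrow> (h \<cdot> g) \<cdot> f = h \<cdot> (g \<cdot> f)"

locale monoidal_category = category +
  assumes tensor_hom:
      "\<lbrakk>f \<in> hom C A B; g \<in> hom C A' B'\<rbrakk> \<Longrightarrow> f \<boxtimes> g \<in> hom C (A \<otimes> A') (B \<otimes> B')"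
    and tensor_Id: "Id C A \<boxtimes> Id C B = Id C (A \<otimes> B)"
    and tensor_Comp:
      "\<lbrakk>f \<in> hom C A B; g \<in> hom C B D; f' \<in> hom C A' B'; g' \<in> hom C B' D'\<rbrakk>
        \<Longrightarrow> (g \<cdot> f) \<boxtimes> (g' \<cdot> f') = (g \<boxtimes> g') \<cdot> (f \<boxtimes> f')"
    and assoc_hom: "assoc C A B D \<in> hom C ((A \<otimes> B) \<otimes> D) (A \<otimes> (B \<otimes> D))"
    and assoc'_hom: "assoc' C A B D \<in> hom C (A \<otimes> (B \<otimes> D)) ((A \<otimes> B) \<otimes> D)"
    and assoc'_assoc: "assoc' C A B D \<cdot> assoc C A B D = Id C ((A \<otimes> B) \<otimes> D)"
    and assoc_assoc': "assoc C A B D \<cdot> assoc' C A B D = Id C (A \<otimes> (B \<otimes> D))"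
    and assoc_natural:
      "\<lbrakk>f \<in> hom C A A'; g \<in> hom C B B'; h \<in> hom C D D'\<rbrakk>
        \<Longrightarrow> assoc C A' B' D' \<cdot> ((f \<boxtimes> g) \<boxtimes> h) = (f \<boxtimes> (g \<boxtimes> h)) \<cdot> assoc C A B D"
    and lunit_hom: "lunit C A \<in> hom C (\<I> \<otimes> A) A"
    and lunit'_hom: "lunit' C A \<in> hom C A (\<I> \<otimes> A)"
    and lunit'_lunit: "lunit' C A \<cdot> lunit C A = Id C (\<I> \<otimes> A)"
    and lunit_lunit': "lunit C A \<cdot> lunit' C A = Id C A"
    and lunit_natural:
      "f \<in> hom C A B \<Longrightarrow> lunit C B \<cdot> (Id C \<I> \<boxtimes> f) = f \<cdot> lunit C A"
    and runit_hom: "runit C A \<in> hom C (A \<otimes> \<I>) A"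
    and runit'_hom: "runit' C A \<in> hom C A (A \<otimes> \<I>)"
    and runit'_runit: "runit' C A \<cdot> runit C A = Id C (A \<otimes> \<I>)"
    and runit_runit': "runit C A \<cdot> runit' C A = Id C A"
    and runit_natural:
      "f \<in> hom C A B \<Longrightarrow> runit C B \<cdot> (f \<boxtimes> Id C \<I>) = f \<cdot> runit C A"
    and triangle: "(Id C A \<boxtimes> lunit C B) \<cdot> assoc C A \<I> B = runit C A \<boxtimes> Id C B"
    and pentagon:
      "(Id C A \<boxtimes> assoc C B D E) \<cdot> assoc C A (B \<otimes> D) E \<cdot> (assoc C A B D \<boxtimes> Id C E)
        = assoc C A B (D \<otimes> E) \<cdot> assoc C (A \<otimes> B) D E"

locale symmetric_monoidal_category = monoidal_category +
  assumes swap_hom: "swap C A B \<in> hom C (A \<otimes> B) (B \<otimes> A)"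
    and swap_natural:
      "\<lbrakk>f \<in> hom C A A'; g \<in> hom C B B'\<rbrakk>
        \<Longrightarrow> swap C A' B' \<cdot> (f \<boxtimes> g) = (g \<boxtimes> f) \<cdot> swap C A B"
    and swap_swap: "swap C B A \<cdot> swap C A B = Id C (A \<otimes> B)"
    and hexagon:
      "assoc C B D A \<cdot> swap C A (B \<otimes> D) \<cdot> assoc C A B D
        = (Id C B \<boxtimes> swap C A D) \<cdot> assoc C B A D \<cdot> (swap C A B \<boxtimes> Id C D)"

text \<open>The swap \<open>(A \<otimes> B) \<otimes> (D \<otimes> E) \<rightarrow> (A \<otimes> D) \<otimes> (B \<otimes> E)\<close> of the middle factors.\<close>

definition swap_middle ::
    "('o, 'm, 'z) markov_data_scheme \<Rightarrow> 'o \<Rightarrow> 'o \<Rightarrow> 'o \<Rightarrow> 'o \<Rightarrow> 'm" where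
  "swap_middle C A B D E =
     assoc' C A D (B \<otimes>\<^bsub>C\<^esub> E)
       \<cdot>\<^bsub>C\<^esub> (Id C A \<boxtimes>\<^bsub>C\<^esub> (assoc C D B E \<cdot>\<^bsub>C\<^esub> (swap C B D \<boxtimes>\<^bsub>C\<^esub> Id C E) \<cdot>\<^bsub>C\<^esub> assoc' C B D E))
       \<cdot>\<^bsub>C\<^esub> assoc C A B (D \<otimes>\<^bsub>C\<^esub> E)"

locale markov_category = symmetric_monoidal_category +
  assumes del_hom: "del C A \<in> hom C A \<I>"
    and del_unique: "f \<in> hom C A \<I> \<Longrightarrow> f = del C A"
    and copy_hom: "copy C A \<in> hom C A (A \<otimes> A)"
    and copy_coassoc:
      "assoc C A A A \<cdot> (copy C A \<boxtimes> Id C A) \<cdot> copy C A = (Id C A \<boxtimes> copy C A) \<cdot> copy C A"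
    and copy_counit_left: "lunit C A \<cdot> (del C A \<boxtimes> Id C A) \<cdot> copy C A = Id C A"
    and copy_counit_right: "runit C A \<cdot> (Id C A \<boxtimes> del C A) \<cdot> copy C A = Id C A"
    and copy_comm: "swap C A A \<cdot> copy C A = copy C A"
    and copy_tensor: "copy C (A \<otimes> B) = swap_middle C A A B B \<cdot> (copy C A \<boxtimes> copy C B)"
    and del_tensor: "del C (A \<otimes> B) = lunit C \<I> \<cdot> (del C A \<boxtimes> del C B)"

definition has_conditionals :: "('o, 'm, 'z) markov_data_scheme \<Rightarrow> bool" where
  "has_conditionals C \<longleftrightarrow>
     (\<forall>A X Y. \<forall>f \<in> hom C A (X \<otimes>\<^bsub>C\<^esub> Y). \<exists>c \<in> hom C (A \<otimes>\<^bsub>C\<^esub> X) Y.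
        let fX = runit C X \<cdot>\<^bsub>C\<^esub> (Id C X \<boxtimes>\<^bsub>C\<^esub> del C Y) \<cdot>\<^bsub>C\<^esub> f;
            \<sigma> = assoc C X A X \<cdot>\<^bsub>C\<^esub> (swap C A X \<boxtimes>\<^bsub>C\<^esub> Id C X) \<cdot>\<^bsub>C\<^esub> assoc' C A X X
        in f = (Id C X \<boxtimes>\<^bsub>C\<^esub> c) \<cdot>\<^bsub>C\<^esub> \<sigma> \<cdot>\<^bsub>C\<^esub> (Id C A \<boxtimes>\<^bsub>C\<^esub> copy C X) \<cdot>\<^bsub>C\<^esub> (Id C A \<boxtimes>\<^bsub>C\<^esub> fX) \<cdot>\<^bsub>C\<^esub> copy C A)"


section \<open>Tensor products of labelled factors and marginals\<close>

text \<open>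
  A bracketed tensor product of labelled factors. Labels record which factor is meant even when
  two factors are the same object, so that reorderings of factors are unambiguous.
\<close>

datatype 'l factors = Unit | Factor 'l | Tens "'l factors" "'l factors"

primrec obj :: "('o, 'm, 'z) markov_data_scheme \<Rightarrow> ('l \<Rightarrow> 'o) \<Rightarrow> 'l factors \<Rightarrow> 'o" where
  "obj C F Unit = \<I>\<^bsub>C\<^esub>"
| "obj C F (Factor l) = F l"
| "obj C F (Tens u v) = obj C F u \<otimes>\<^bsub>C\<^esub> obj C F v"

text \<open>
  \<open>marginalization C F u v \<phi>\<close>: the morphism \<open>\<phi>\<close> from \<open>obj C F u\<close> to \<open>obj C F v\<close> deletes the
  factors of \<open>u\<close> that are missing in \<open>v\<close> and reorders and rebrackets the others; it is built from
  \<open>del\<close>, symmetries and coherence isomorphisms. If no label is repeated in \<open>u\<close>, such a \<open>\<phi>\<close> is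
  unique, by coherence and terminality of the unit.
\<close>

inductive marginalization ::
    "('o, 'm, 'z) markov_data_scheme \<Rightarrow> ('l \<Rightarrow> 'o) \<Rightarrow> 'l factors \<Rightarrow> 'l factors \<Rightarrow> 'm \<Rightarrow> bool"
  for C :: "('o, 'm, 'z) markov_data_scheme" and F :: "'l \<Rightarrow> 'o" where
  Id: "marginalization C F u u (Id C (obj C F u))"
| Comp: "\<lbrakk>marginalization C F u v \<phi>; marginalization C F v w \<psi>\<rbrakk>
    \<Longrightarrow> marginalization C F u w (\<psi> \<cdot>\<^bsub>C\<^esub> \<phi>)"
| tensor: "\<lbrakk>marginalization C F u v \<phi>; marginalization C F u' v' \<psi>\<rbrakk>
    \<Longrightarrow> marginalization C F (Tens u u') (Tens v v') (\<phi> \<boxtimes>\<^bsub>C\<^esub> \<psi>)"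
| del: "marginalization C F u Unit (del C (obj C F u))"
| swap: "marginalization C F (Tens u v) (Tens v u) (swap C (obj C F u) (obj C F v))"
| assoc: "marginalization C F (Tens (Tens u v) w) (Tens u (Tens v w))
    (assoc C (obj C F u) (obj C F v) (obj C F w))"
| assoc': "marginalization C F (Tens u (Tens v w)) (Tens (Tens u v) w)
    (assoc' C (obj C F u) (obj C F v) (obj C F w))"
| lunit: "marginalization C F (Tens Unit u) u (lunit C (obj C F u))"
| lunit': "marginalization C F u (Tens Unit u) (lunit' C (obj C F u))"
| runit: "marginalization C F (Tens u Unit) u (runit C (obj C F u))"
| runit': "marginalization C F u (Tens u Unit) (runit' C (obj C F u))"

definition is_marginal ::
    "('o, 'm, 'z) markov_data_scheme \<Rightarrow> ('l \<Rightarrow> 'o) \<Rightarrow> 'l factors \<Rightarrow> 'm \<Rightarrow> 'l factors \<Rightarrow> 'm \<Rightarrow> bool" where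
  "is_marginal C F w p v q \<longleftrightarrow> (\<exists>\<phi>. marginalization C F w v \<phi> \<and> q = \<phi> \<cdot>\<^bsub>C\<^esub> p)"

definition copy3 :: "('o, 'm, 'z) markov_data_scheme \<Rightarrow> 'o \<Rightarrow> 'm" where
  "copy3 C A = (Id C A \<boxtimes>\<^bsub>C\<^esub> copy C A) \<cdot>\<^bsub>C\<^esub> copy C A"

text \<open>\<open>displays C F w p u v z\<close>: the state \<open>p\<close> on the factors \<open>w\<close> displays \<open>u \<bottom> v | z\<close>.\<close>

definition displays ::
    "('o, 'm, 'z) markov_data_scheme \<Rightarrow> ('l \<Rightarrow> 'o) \<Rightarrow> 'l factors \<Rightarrow> 'm
      \<Rightarrow> 'l factors \<Rightarrow> 'l factors \<Rightarrow> 'l factors \<Rightarrow> bool" where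
  "displays C F w p u v z \<longleftrightarrow>
     (\<exists>q r a b. is_marginal C F w p (Tens u (Tens v z)) q \<and> is_marginal C F w p z r
        \<and> a \<in> hom C (obj C F z) (obj C F u) \<and> b \<in> hom C (obj C F z) (obj C F v)
        \<and> q = (a \<boxtimes>\<^bsub>C\<^esub> (b \<boxtimes>\<^bsub>C\<^esub> Id C (obj C F z))) \<cdot>\<^bsub>C\<^esub> copy3 C (obj C F z) \<cdot>\<^bsub>C\<^esub> r)"

text \<open>Iterated tensor products are bracketed to the left and start from the unit.\<close>

definition obj_list :: "('o, 'm, 'z) markov_data_scheme \<Rightarrow> 'o list \<Rightarrow> 'o" where
  "obj_list C As = foldl (tensor C) \<I>\<^bsub>C\<^esub> As"

definition map_list :: "('o, 'm, 'z) markov_data_scheme \<Rightarrow> 'm list \<Rightarrow> 'm" where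
  "map_list C fs = foldl (tensor_map C) (Id C \<I>\<^bsub>C\<^esub>) fs"

definition factors_list :: "'l factors list \<Rightarrow> 'l factors" where
  "factors_list us = foldl Tens Unit us"


section \<open>Hidden Markov models\<close>

datatype label = X_label nat | Y_label nat

definition initial :: "int \<Rightarrow> nat set" where
  "initial k = {i. int i \<le> k}"

definition XS :: "nat set \<Rightarrow> label factors" where
  "XS R = factors_list (map (\<lambda>i. Factor (X_label i)) (sorted_list_of_set R))"

definition YS :: "nat set \<Rightarrow> label factors" where
  "YS U = factors_list (map (\<lambda>i. Factor (Y_label i)) (sorted_list_of_set U))"

definition all_factors :: "nat \<Rightarrow> label factors" where
  "all_factors n = factors_list (map (\<lambda>t. Tens (Factor (X_label t)) (Factor (Y_label t))) [0..<Suc n])"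

definition indep ::
    "('o, 'm, 'z) markov_data_scheme \<Rightarrow> (nat \<Rightarrow> 'o) \<Rightarrow> (nat \<Rightarrow> 'o) \<Rightarrow> nat \<Rightarrow> 'm
      \<Rightarrow> label factors \<Rightarrow> label factors \<Rightarrow> label factors \<Rightarrow> bool" where
  "indep C X Y n p u v z \<longleftrightarrow> displays C (case_label X Y) (all_factors n) p u v z"

definition backward_markov ::
    "('o, 'm, 'z) markov_data_scheme \<Rightarrow> (nat \<Rightarrow> 'o) \<Rightarrow> (nat \<Rightarrow> 'o) \<Rightarrow> nat \<Rightarrow> 'm \<Rightarrow> bool" where
  "backward_markov C X Y n p \<longleftrightarrow>
     (\<forall>t \<in> {1..n}. indep C X Y n p
        (Factor (X_label t)) (Tens (XS (initial (int t - 2))) (YS (initial (int t - 1)))) (Factor (X_label (t - 1))))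
   \<and> (\<forall>t \<in> {1..n}. indep C X Y n p
        (Factor (Y_label t)) (Tens (YS (initial (int t - 1))) (XS (initial (int t - 1)))) (Factor (X_label t)))"

definition local_markov ::
    "('o, 'm, 'z) markov_data_scheme \<Rightarrow> (nat \<Rightarrow> 'o) \<Rightarrow> (nat \<Rightarrow> 'o) \<Rightarrow> nat \<Rightarrow> 'm \<Rightarrow> bool" where
  "local_markov C X Y n p \<longleftrightarrow>
     (\<forall>t \<in> {1..n}. indep C X Y n p
        (Factor (X_label t)) (Tens (XS (initial (int t - 2))) (YS (initial (int t - 1)))) (Factor (X_label (t - 1))))
   \<and> (\<forall>t \<in> {0..n}. indep C X Y n p
        (Factor (Y_label t)) (Tens (XS (initial (int n) - {t})) (YS (initial (int n) - {t}))) (Factor (X_label t)))"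

text \<open>
  The last two separation conditions concern the pairs \<open>X\<^sub>r, Y\<^sub>w\<close> and \<open>Y\<^sub>u, X\<^sub>t\<close> on opposite sides of
  the independence. Without them the property fails already for \<open>n = 0\<close>, \<open>R = W = {0}\<close> and all
  other sets empty, where it would claim that \<open>X\<^sub>0\<close> and \<open>Y\<^sub>0\<close> are independent.
\<close>

definition global_markov ::
    "('o, 'm, 'z) markov_data_scheme \<Rightarrow> (nat \<Rightarrow> 'o) \<Rightarrow> (nat \<Rightarrow> 'o) \<Rightarrow> nat \<Rightarrow> 'm \<Rightarrow> bool" where
  "global_markov C X Y n p \<longleftrightarrow>
     (\<forall>R S T U V W.
        R \<subseteq> initial (int n) \<and> S \<subseteq> initial (int n) \<and> T \<subseteq> initial (int n)
      \<and> U \<subseteq> initial (int n) \<and> V \<subseteq> initial (int n) \<and> W \<subseteq> initial (int n)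
      \<and> R \<inter> S = {} \<and> R \<inter> T = {} \<and> S \<inter> T = {}
      \<and> U \<inter> V = {} \<and> U \<inter> W = {} \<and> V \<inter> W = {}
      \<and> (\<forall>r \<in> R. \<forall>t \<in> T. \<exists>s \<in> S. r < s \<and> s < t \<or> r > s \<and> s > t)
      \<and> (\<forall>u \<in> U. \<forall>w \<in> W. \<exists>s \<in> S. u \<le> s \<and> s \<le> w \<or> u \<ge> s \<and> s \<ge> w)
      \<and> (\<forall>r \<in> R. \<forall>w \<in> W. \<exists>s \<in> S. r < s \<and> s \<le> w \<or> r > s \<and> s \<ge> w)
      \<and> (\<forall>u \<in> U. \<forall>t \<in> T. \<exists>s \<in> S. u \<le> s \<and> s < t \<or> u \<ge> s \<and> s > t)
      \<longrightarrow> indep C X Y n p (Tens (XS R) (YS U)) (Tens (XS T) (YS W)) (Tens (XS S) (YS V)))"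

text \<open>
  \<open>chain C X f t\<close> is the state \<open>m\<^sub>t\<close> on \<open>X\<^sub>0 \<otimes> \<dots> \<otimes> X\<^sub>t\<close>, bracketed as in \<open>obj_list\<close>; \<open>lunit'\<close> and
  \<open>assoc'\<close> only provide that bracketing.
\<close>

primrec chain :: "('o, 'm, 'z) markov_data_scheme \<Rightarrow> (nat \<Rightarrow> 'o) \<Rightarrow> (nat \<Rightarrow> 'm) \<Rightarrow> nat \<Rightarrow> 'm" where
  "chain C X f 0 = lunit' C (X 0) \<cdot>\<^bsub>C\<^esub> f 0"
| "chain C X f (Suc t) =
     assoc' C (obj_list C (map X [0..<t])) (X t) (X (Suc t))
       \<cdot>\<^bsub>C\<^esub> (Id C (obj_list C (map X [0..<t])) \<boxtimes>\<^bsub>C\<^esub> ((Id C (X t) \<boxtimes>\<^bsub>C\<^esub> f (Suc t)) \<cdot>\<^bsub>C\<^esub> copy C (X t)))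
       \<cdot>\<^bsub>C\<^esub> chain C X f t"

definition hidden_markov_form ::
    "('o, 'm, 'z) markov_data_scheme \<Rightarrow> (nat \<Rightarrow> 'o) \<Rightarrow> (nat \<Rightarrow> 'o) \<Rightarrow> nat \<Rightarrow> 'm \<Rightarrow> bool" where
  "hidden_markov_form C X Y n p \<longleftrightarrow>
     (\<exists>f g. f 0 \<in> hom C \<I>\<^bsub>C\<^esub> (X 0)
        \<and> (\<forall>t \<in> {1..n}. f t \<in> hom C (X (t - 1)) (X t))
        \<and> (\<forall>t \<in> {0..n}. g t \<in> hom C (X t) (Y t))
        \<and> p = map_list C (map (\<lambda>t. (Id C (X t) \<boxtimes>\<^bsub>C\<^esub> g t) \<cdot>\<^bsub>C\<^esub> copy C (X t)) [0..<Suc n])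
              \<cdot>\<^bsub>C\<^esub> chain C X f n)"

end

theory Submission
  imports Defs
begin

text \<open>
  Deterministic morphisms form a cartesian category containing all coherence isomorphisms and
  deletions, so a marginalization of distinctly labelled factors is determined by its components,
  and conditional independence becomes a statement about deterministic variables on one sample
  space. Conditionals make this relation a separoid on sets of labels.
  The variables form a tree in which each \<open>X t\<close> is attached to \<open>X (t - 1)\<close> and each \<open>Y t\<close> to
  \<open>X t\<close>. The backward Markov property says that, in the order \<open>X 0, Y 0, X 1, Y 1, \<dots>\<close>, every new
  variable is independent of the previous ones given its neighbour; the global property follows by
  adding the leaves one at a time. Finally, the kernels displaying the local independences are the
  transition and emission kernels of the hidden Markov form.
\<close>

section \<open>Projections in a symmetric monoidal category with terminal unit\<close>

context markov_category
begin

text \<open>The obstacle is that pairing is not natural: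
  \<open>\<langle>f, g\<rangle> \<cdot> d\<close> splits into components when \<open>d\<close> is
  deterministic, but not in general, because copying one random outcome differs from sampling twice.
  Calculations therefore avoid pushing a kernel through a copy; they apply reorderings and kernels
  after tuples of variables. A conditional independence then says that, in the joint law with some
  spectators, a variable may be replaced by the output of a kernel. Two such kernels agree only
  almost surely, that is, paired with their common input. Conditionals carry this agreement over to
  further spectators, and this is what contraction rests on. Label sets may overlap, since reading a
  deterministic variable twice is harmless; the leaf argument needs this, because the neighbour of
  the leaf may already lie in the other sets. The form yields the backward property because its
  prefixes are easy to marginalize: dropping the last pair drops the two kernels that produced
  it.\<close>

lemma hom_iff: "f \<in> hom C A B \<longleftrightarrow> Dom C f = A \<and> Cod C f = B"
  by (simp add: hom_def)

lemma in_hom: "f \<in> hom C (Dom C f) (Cod C f)"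
  by (simp add: hom_def)

lemmas homs = Id_hom assoc_hom assoc'_hom lunit_hom lunit'_hom runit_hom runit'_hom
  swap_hom del_hom copy_hom

lemmas Dom_Cod_simps [simp] = homs [unfolded hom_iff, THEN conjunct1] homs [unfolded hom_iff, THEN conjunct2]

text \<open>Composition is total on the type, so the laws carry typing premises. Expressed as
  equations for \<open>Dom\<close> and \<open>Cod\<close>, these are computed by the simplifier and
  no intermediate object has to be guessed.\<close>

lemma Dom_Cod_comp [simp]:
  assumes "Cod C f = Dom C g"
  shows "Dom C (g \<cdot> f) = Dom C f" "Cod C (g \<cdot> f) = Cod C g"
  using Comp_hom [of f "Dom C f" "Cod C f" g "Cod C g"] assms by (auto simp: hom_iff)

lemma Dom_Cod_tensor [simp]:
  "Dom C (f \<boxtimes> g) = Dom C f \<otimes> Dom C g" "Cod C (f \<boxtimes> g) = Cod C f \<otimes> Cod C g"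
  using tensor_hom [OF in_hom in_hom, of f g] by (auto simp: hom_iff)

lemma comp_id [simp]: "A = Dom C f \<Longrightarrow> f \<cdot> Id C A = f"
  and id_comp [simp]: "A = Cod C f \<Longrightarrow> Id C A \<cdot> f = f"
  using Comp_Id [OF in_hom] Id_Comp [OF in_hom] by auto

lemma comp_assoc [simp]:
  "\<lbrakk>Cod C f = Dom C g; Cod C g = Dom C h\<rbrakk> \<Longrightarrow> (h \<cdot> g) \<cdot> f = h \<cdot> g \<cdot> f"
  by (rule Comp_assoc) (auto simp: hom_iff)

lemma tensor_comp:
  "\<lbrakk>Cod C f = Dom C g; Cod C f' = Dom C g'\<rbrakk> \<Longrightarrow> (g \<boxtimes> g') \<cdot> (f \<boxtimes> f') = (g \<cdot> f) \<boxtimes> (g' \<cdot> f')"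
  by (rule tensor_Comp [symmetric]) (auto simp: hom_iff)

lemmas tensor_id [simp] = tensor_Id

lemma comp_reduce:
  "\<lbrakk>g \<cdot> f = h; Cod C f = Dom C g; Cod C k = Dom C f\<rbrakk> \<Longrightarrow> g \<cdot> f \<cdot> k = h \<cdot> k"
  using comp_assoc by metis

lemma assoc_nat:
  "\<lbrakk>A = Cod C f; B = Cod C g; D = Cod C h\<rbrakk> \<Longrightarrow>
    assoc C A B D \<cdot> ((f \<boxtimes> g) \<boxtimes> h) = (f \<boxtimes> (g \<boxtimes> h)) \<cdot> assoc C (Dom C f) (Dom C g) (Dom C h)"
  by (rule assoc_natural) (auto simp: hom_iff)

lemma swap_nat:
  "\<lbrakk>A = Cod C f; B = Cod C g\<rbrakk> \<Longrightarrow> swap C A B \<cdot> (f \<boxtimes> g) = (g \<boxtimes> f) \<cdot> swap C (Dom C f) (Dom C g)"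
  by (rule swap_natural) (auto simp: hom_iff)

lemma lunit_nat: "A = Cod C f \<Longrightarrow> lunit C A \<cdot> (Id C \<I> \<boxtimes> f) = f \<cdot> lunit C (Dom C f)"
  by (rule lunit_natural) (auto simp: hom_iff)

lemma runit_nat: "A = Cod C f \<Longrightarrow> runit C A \<cdot> (f \<boxtimes> Id C \<I>) = f \<cdot> runit C (Dom C f)"
  by (rule runit_natural) (auto simp: hom_iff)

section \<open>Unit coherences that follow from the triangle, the pentagon and the hexagon\<close>

lemma iso_cancel_right:
  assumes "e \<cdot> e' = Id C (Cod C e)" "Dom C e' = Cod C e" "Cod C e' = Dom C e"
    "Dom C f = Cod C e" "Dom C g = Cod C e" "f \<cdot> e = g \<cdot> e"
  shows "f = g"
  using assms by (metis comp_assoc comp_id)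

lemma iso_cancel_left:
  assumes "e' \<cdot> e = Id C (Dom C e)" "Dom C e' = Cod C e" "Cod C e' = Dom C e"
    "Cod C f = Dom C e" "Cod C g = Dom C e" "e \<cdot> f = e \<cdot> g"
  shows "f = g"
  using assms by (metis comp_assoc id_comp)

lemma assoc_iso [simp]:
  "assoc' C A B D \<cdot> assoc C A B D = Id C ((A \<otimes> B) \<otimes> D)"
  "assoc C A B D \<cdot> assoc' C A B D = Id C (A \<otimes> (B \<otimes> D))"
  by (rule assoc'_assoc assoc_assoc')+

text \<open>Naturality of \<open>runit\<close> exhibits \<open>f \<boxtimes> Id C \<I>\<close> as
  \<open>f\<close> between invertible unitors, so tensoring with the unit loses nothing.\<close>

lemma tensor_unit_faithful:
  assumes "f \<boxtimes> Id C \<I> = g \<boxtimes> Id C \<I>" "Dom C f = Dom C g" "Cod C f = Cod C g"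
  shows "f = g"
proof (rule iso_cancel_right [of "runit C (Dom C f)" "runit' C (Dom C f)"])
  show "f \<cdot> runit C (Dom C f) = g \<cdot> runit C (Dom C f)"
    using runit_nat [of "Cod C f" f] runit_nat [of "Cod C g" g] assms by simp
qed (use assms runit_runit' in auto)

lemma unit_tensor_faithful:
  assumes "Id C \<I> \<boxtimes> f = Id C \<I> \<boxtimes> g" "Dom C f = Dom C g" "Cod C f = Cod C g"
  shows "f = g"
proof (rule iso_cancel_right [of "lunit C (Dom C f)" "lunit' C (Dom C f)"])
  show "f \<cdot> lunit C (Dom C f) = g \<cdot> lunit C (Dom C f)"
    using lunit_nat [of "Cod C f" f] lunit_nat [of "Cod C g" g] assms by simp
qed (use assms lunit_lunit' in auto)

text \<open>Kelly's argument: after tensoring with \<open>\<I>\<close> on the right and composing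
  with an associator, both sides become legs of the pentagon for \<open>A\<close>, \<open>B\<close>,
  \<open>\<I>\<close>, \<open>\<I>\<close>, and the triangle removes the inner units.\<close>

lemma runit_tensor: "(Id C A \<boxtimes> runit C B) \<cdot> assoc C A B \<I> = runit C (A \<otimes> B)"
proof (rule tensor_unit_faithful)
  have "assoc C A B \<I> \<cdot> (((Id C A \<boxtimes> runit C B) \<cdot> assoc C A B \<I>) \<boxtimes> Id C \<I>)
      = assoc C A B \<I> \<cdot> ((Id C A \<boxtimes> runit C B) \<boxtimes> Id C \<I>) \<cdot> (assoc C A B \<I> \<boxtimes> Id C \<I>)"
    by (simp add: tensor_comp)
  also have "\<dots> = (assoc C A B \<I> \<cdot> ((Id C A \<boxtimes> runit C B) \<boxtimes> Id C \<I>)) \<cdot> (assoc C A B \<I> \<boxtimes> Id C \<I>)"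
    by simp
  also have "\<dots> = (Id C A \<boxtimes> (runit C B \<boxtimes> Id C \<I>)) \<cdot> assoc C A (B \<otimes> \<I>) \<I> \<cdot> (assoc C A B \<I> \<boxtimes> Id C \<I>)"
    by (simp add: assoc_nat)
  also have "\<dots> = (Id C A \<boxtimes> (Id C B \<boxtimes> lunit C \<I>)) \<cdot>
      ((Id C A \<boxtimes> assoc C B \<I> \<I>) \<cdot> assoc C A (B \<otimes> \<I>) \<I> \<cdot> (assoc C A B \<I> \<boxtimes> Id C \<I>))"
    by (simp flip: comp_assoc add: tensor_comp triangle)
  also have "\<dots> = (Id C A \<boxtimes> (Id C B \<boxtimes> lunit C \<I>)) \<cdot> assoc C A B (\<I> \<otimes> \<I>) \<cdot> assoc C (A \<otimes> B) \<I> \<I>"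
    by (simp only: pentagon)
  also have "\<dots> = ((Id C A \<boxtimes> (Id C B \<boxtimes> lunit C \<I>)) \<cdot> assoc C A B (\<I> \<otimes> \<I>)) \<cdot> assoc C (A \<otimes> B) \<I> \<I>"
    by simp
  also have "\<dots> = (assoc C A B \<I> \<cdot> ((Id C A \<boxtimes> Id C B) \<boxtimes> lunit C \<I>)) \<cdot> assoc C (A \<otimes> B) \<I> \<I>"
    by (subst assoc_nat) (simp_all del: tensor_id)
  also have "\<dots> = assoc C A B \<I> \<cdot> (runit C (A \<otimes> B) \<boxtimes> Id C \<I>)"
    by (simp add: triangle)
  finally show "((Id C A \<boxtimes> runit C B) \<cdot> assoc C A B \<I>) \<boxtimes> Id C \<I> = runit C (A \<otimes> B) \<boxtimes> Id C \<I>"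
    by (rule iso_cancel_left [rotated -1, of "assoc C A B \<I>" _ _ "assoc' C A B \<I>"]) simp_all
qed simp_all

text \<open>The mirror image, with the pentagon for \<open>\<I>\<close>, \<open>\<I>\<close>,
  \<open>A\<close>, \<open>B\<close>; the invertible morphism \<open>?e\<close> consists of the
  first two arrows of its longer side and is cancelled at the end.\<close>

lemma lunit_tensor: "lunit C (A \<otimes> B) \<cdot> assoc C \<I> A B = lunit C A \<boxtimes> Id C B"
proof (rule unit_tensor_faithful)
  let ?e = "assoc C \<I> (\<I> \<otimes> A) B \<cdot> (assoc C \<I> \<I> A \<boxtimes> Id C B)"
  let ?e' = "(assoc' C \<I> \<I> A \<boxtimes> Id C B) \<cdot> assoc' C \<I> (\<I> \<otimes> A) B"
  have "(Id C \<I> \<boxtimes> (lunit C (A \<otimes> B) \<cdot> assoc C \<I> A B)) \<cdot> ?e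
     = (Id C \<I> \<boxtimes> lunit C (A \<otimes> B)) \<cdot> ((Id C \<I> \<boxtimes> assoc C \<I> A B) \<cdot> ?e)"
    by (simp flip: comp_assoc add: tensor_comp)
  also have "\<dots> = (Id C \<I> \<boxtimes> lunit C (A \<otimes> B)) \<cdot> assoc C \<I> \<I> (A \<otimes> B) \<cdot> assoc C (\<I> \<otimes> \<I>) A B"
    by (simp only: pentagon)
  also have "\<dots> = ((Id C \<I> \<boxtimes> lunit C (A \<otimes> B)) \<cdot> assoc C \<I> \<I> (A \<otimes> B)) \<cdot> assoc C (\<I> \<otimes> \<I>) A B"
    by simp
  also have "\<dots> = (runit C \<I> \<boxtimes> (Id C A \<boxtimes> Id C B)) \<cdot> assoc C (\<I> \<otimes> \<I>) A B"
    by (simp add: triangle)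
  also have "\<dots> = assoc C \<I> A B \<cdot> ((runit C \<I> \<boxtimes> Id C A) \<boxtimes> Id C B)"
    by (subst assoc_nat) (simp_all del: tensor_id)
  also have "\<dots> = assoc C \<I> A B \<cdot> ((Id C \<I> \<boxtimes> lunit C A) \<boxtimes> Id C B) \<cdot> (assoc C \<I> \<I> A \<boxtimes> Id C B)"
    by (simp add: tensor_comp triangle [symmetric])
  also have "\<dots> = (assoc C \<I> A B \<cdot> ((Id C \<I> \<boxtimes> lunit C A) \<boxtimes> Id C B)) \<cdot> (assoc C \<I> \<I> A \<boxtimes> Id C B)"
    by simp
  also have "\<dots> = (Id C \<I> \<boxtimes> (lunit C A \<boxtimes> Id C B)) \<cdot> ?e"
    by (simp add: assoc_nat)
  finally show "Id C \<I> \<boxtimes> (lunit C (A \<otimes> B) \<cdot> assoc C \<I> A B) = Id C \<I> \<boxtimes> (lunit C A \<boxtimes> Id C B)"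
  proof (rule iso_cancel_right [rotated -1, of _ ?e _ ?e'])
    have "?e \<cdot> ?e' = assoc C \<I> (\<I> \<otimes> A) B \<cdot>
        ((assoc C \<I> \<I> A \<boxtimes> Id C B) \<cdot> (assoc' C \<I> \<I> A \<boxtimes> Id C B)) \<cdot> assoc' C \<I> (\<I> \<otimes> A) B"
      by simp
    then show "?e \<cdot> ?e' = Id C (Cod C ?e)"
      by (simp add: tensor_comp)
  qed simp_all
qed simp_all

lemma eq_del: "Cod C f = \<I> \<Longrightarrow> f = del C (Dom C f)"
  by (rule del_unique) (simp add: hom_iff)

lemma eq_to_unit: "\<lbrakk>Cod C f = \<I>; Cod C g = \<I>; Dom C f = Dom C g\<rbrakk> \<Longrightarrow> f = g"
  using eq_del by metis

text \<open>The hexagon for \<open>A\<close>, \<open>\<I>\<close>, \<open>\<I>\<close> turns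
  \<open>?s\<close> after \<open>runit C A \<boxtimes> Id C \<I>\<close> into \<open>?s\<close>
  after \<open>?s \<boxtimes> Id C \<I>\<close>; cancelling the isomorphism \<open>?s\<close> leaves
  the claim tensored with the unit.\<close>

lemma lunit_swap: "lunit C A \<cdot> swap C A \<I> = runit C A"
proof -
  let ?s = "lunit C A \<cdot> swap C A \<I>"
  \<comment> \<open>Terminality of the unit gives this coherence at once.\<close>
  have lr: "lunit C \<I> = runit C \<I>" by (rule eq_to_unit) simp_all
  have "?s \<cdot> (runit C A \<boxtimes> Id C \<I>) = ?s \<cdot> (Id C A \<boxtimes> lunit C \<I>) \<cdot> assoc C A \<I> \<I>"
    by (simp add: triangle)
  also have "\<dots> = lunit C A \<cdot> (swap C A \<I> \<cdot> (Id C A \<boxtimes> lunit C \<I>)) \<cdot> assoc C A \<I> \<I>"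
    by simp
  also have "\<dots> = lunit C A \<cdot> (runit C \<I> \<boxtimes> Id C A) \<cdot> swap C A (\<I> \<otimes> \<I>) \<cdot> assoc C A \<I> \<I>"
    by (simp add: swap_nat lr)
  also have "\<dots> = lunit C A \<cdot> (Id C \<I> \<boxtimes> lunit C A) \<cdot> (assoc C \<I> \<I> A \<cdot> swap C A (\<I> \<otimes> \<I>) \<cdot> assoc C A \<I> \<I>)"
    by (simp add: triangle [symmetric])
  also have "\<dots> = lunit C A \<cdot> (Id C \<I> \<boxtimes> lunit C A) \<cdot> (Id C \<I> \<boxtimes> swap C A \<I>)
      \<cdot> assoc C \<I> A \<I> \<cdot> (swap C A \<I> \<boxtimes> Id C \<I>)"
    by (simp only: hexagon)
  also have "\<dots> = (lunit C A \<cdot> (Id C \<I> \<boxtimes> ?s)) \<cdot> assoc C \<I> A \<I> \<cdot> (swap C A \<I> \<boxtimes> Id C \<I>)"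
    by (simp flip: comp_assoc add: tensor_comp)
  also have "\<dots> = ?s \<cdot> (lunit C (A \<otimes> \<I>) \<cdot> assoc C \<I> A \<I>) \<cdot> (swap C A \<I> \<boxtimes> Id C \<I>)"
    by (simp add: lunit_nat)
  also have "\<dots> = ?s \<cdot> (?s \<boxtimes> Id C \<I>)"
    unfolding lunit_tensor by (simp add: tensor_comp)
  finally have "runit C A \<boxtimes> Id C \<I> = ?s \<boxtimes> Id C \<I>"
  proof (rule iso_cancel_left [rotated -1, of ?s _ _ "swap C \<I> A \<cdot> lunit' C A"])
    have "(swap C \<I> A \<cdot> lunit' C A) \<cdot> ?s = swap C \<I> A \<cdot> (lunit' C A \<cdot> lunit C A) \<cdot> swap C A \<I>"
      by simp
    then show "(swap C \<I> A \<cdot> lunit' C A) \<cdot> ?s = Id C (Dom C ?s)"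
      by (simp add: lunit'_lunit swap_swap)
  qed simp_all
  then show ?thesis by (rule tensor_unit_faithful [symmetric]) simp_all
qed

lemma runit_swap: "runit C A \<cdot> swap C \<I> A = lunit C A"
  by (simp add: lunit_swap [symmetric] swap_swap)


section \<open>Projections of a tensor product and their behaviour under the structure
  isomorphisms\<close>

definition pr1 :: "'a \<Rightarrow> 'a \<Rightarrow> 'b" where
  "pr1 A B = runit C A \<cdot> (Id C A \<boxtimes> del C B)"

definition pr2 :: "'a \<Rightarrow> 'a \<Rightarrow> 'b" where
  "pr2 A B = lunit C B \<cdot> (del C A \<boxtimes> Id C B)"

lemma Dom_Cod_pr [simp]:
  "Dom C (pr1 A B) = A \<otimes> B" "Cod C (pr1 A B) = A"
  "Dom C (pr2 A B) = A \<otimes> B" "Cod C (pr2 A B) = B"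
  by (simp_all add: pr1_def pr2_def)

lemma del_comp [simp]: "A = Cod C f \<Longrightarrow> del C A \<cdot> f = del C (Dom C f)"
  by (rule eq_to_unit) simp_all

text \<open>Deleting the output of \<open>g\<close> is the same as deleting its input, since the
  unit is terminal; hence \<open>g\<close> disappears even if it is random.\<close>

lemma pr1_tensor:
  assumes "A = Cod C f" "B = Cod C g"
  shows "pr1 A B \<cdot> (f \<boxtimes> g) = f \<cdot> pr1 (Dom C f) (Dom C g)"
proof -
  have "pr1 A B \<cdot> (f \<boxtimes> g) = runit C A \<cdot> (f \<boxtimes> Id C \<I>) \<cdot> (Id C (Dom C f) \<boxtimes> del C (Dom C g))"
    using assms by (simp add: pr1_def tensor_comp)
  also have "\<dots> = (runit C A \<cdot> (f \<boxtimes> Id C \<I>)) \<cdot> (Id C (Dom C f) \<boxtimes> del C (Dom C g))"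
    using assms by simp
  finally show ?thesis using assms by (simp add: runit_nat pr1_def)
qed

lemma pr2_tensor:
  assumes "A = Cod C f" "B = Cod C g"
  shows "pr2 A B \<cdot> (f \<boxtimes> g) = g \<cdot> pr2 (Dom C f) (Dom C g)"
proof -
  have "pr2 A B \<cdot> (f \<boxtimes> g) = lunit C B \<cdot> (Id C \<I> \<boxtimes> g) \<cdot> (del C (Dom C f) \<boxtimes> Id C (Dom C g))"
    using assms by (simp add: pr2_def tensor_comp)
  also have "\<dots> = (lunit C B \<cdot> (Id C \<I> \<boxtimes> g)) \<cdot> (del C (Dom C f) \<boxtimes> Id C (Dom C g))"
    using assms by simp
  finally show ?thesis using assms by (simp add: lunit_nat pr2_def)
qed

lemma pr1_assoc: "(Id C A \<boxtimes> pr1 B D) \<cdot> assoc C A B D = pr1 (A \<otimes> B) D"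
proof -
  have "(Id C A \<boxtimes> pr1 B D) \<cdot> assoc C A B D
      = (Id C A \<boxtimes> runit C B) \<cdot> ((Id C A \<boxtimes> (Id C B \<boxtimes> del C D)) \<cdot> assoc C A B D)"
    by (simp flip: comp_assoc add: tensor_comp pr1_def)
  also have "(Id C A \<boxtimes> (Id C B \<boxtimes> del C D)) \<cdot> assoc C A B D
      = assoc C A B \<I> \<cdot> ((Id C A \<boxtimes> Id C B) \<boxtimes> del C D)"
    by (subst assoc_nat) (simp_all del: tensor_id)
  finally show ?thesis
    by (simp flip: comp_assoc add: runit_tensor) (simp add: pr1_def)
qed

lemma pr2_pr1_assoc: "(Id C A \<boxtimes> pr2 B D) \<cdot> assoc C A B D = pr1 A B \<boxtimes> Id C D"
proof -
  have "(Id C A \<boxtimes> pr2 B D) \<cdot> assoc C A B D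
      = (Id C A \<boxtimes> lunit C D) \<cdot> ((Id C A \<boxtimes> (del C B \<boxtimes> Id C D)) \<cdot> assoc C A B D)"
    by (simp flip: comp_assoc add: tensor_comp pr2_def)
  also have "(Id C A \<boxtimes> (del C B \<boxtimes> Id C D)) \<cdot> assoc C A B D
      = assoc C A \<I> D \<cdot> ((Id C A \<boxtimes> del C B) \<boxtimes> Id C D)"
    by (subst assoc_nat) simp_all
  finally show ?thesis
    by (simp flip: comp_assoc add: triangle) (simp add: pr1_def tensor_comp)
qed

lemma pr2_assoc: "pr2 A (B \<otimes> D) \<cdot> assoc C A B D = pr2 A B \<boxtimes> Id C D"
proof -
  have "pr2 A (B \<otimes> D) \<cdot> assoc C A B D
      = lunit C (B \<otimes> D) \<cdot> (del C A \<boxtimes> (Id C B \<boxtimes> Id C D)) \<cdot> assoc C A B D"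
    by (simp add: pr2_def)
  also have "(del C A \<boxtimes> (Id C B \<boxtimes> Id C D)) \<cdot> assoc C A B D
      = assoc C \<I> B D \<cdot> ((del C A \<boxtimes> Id C B) \<boxtimes> Id C D)"
    by (subst assoc_nat) (simp_all del: tensor_id)
  finally show ?thesis
    by (simp flip: comp_assoc add: lunit_tensor) (simp add: pr2_def tensor_comp)
qed

lemma comp_assoc'_eqI:
  assumes "f \<cdot> assoc C A B D = g" "Dom C f = A \<otimes> (B \<otimes> D)"
  shows "g \<cdot> assoc' C A B D = f"
  using assms by auto

lemma pr1_swap: "pr1 B A \<cdot> swap C A B = pr2 A B"
proof -
  have "pr1 B A \<cdot> swap C A B = runit C B \<cdot> (swap C \<I> B \<cdot> (del C A \<boxtimes> Id C B))"
    by (simp add: pr1_def swap_nat)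
  then show ?thesis by (simp flip: comp_assoc add: runit_swap) (simp add: pr2_def)
qed

lemma pr2_swap: "pr2 B A \<cdot> swap C A B = pr1 A B"
proof -
  have "pr2 B A \<cdot> swap C A B = lunit C A \<cdot> (swap C A \<I> \<cdot> (Id C A \<boxtimes> del C B))"
    by (simp add: pr2_def swap_nat)
  then show ?thesis by (simp flip: comp_assoc add: lunit_swap) (simp add: pr1_def)
qed

section \<open>The swap of the middle factors followed by projections\<close>

abbreviation swap_mid_inner :: "'a \<Rightarrow> 'a \<Rightarrow> 'a \<Rightarrow> 'b" where
  "swap_mid_inner B D E \<equiv> assoc C D B E \<cdot> (swap C B D \<boxtimes> Id C E) \<cdot> assoc' C B D E"

lemma pr2_swap_mid_inner: "pr2 D (B \<otimes> E) \<cdot> swap_mid_inner B D E = Id C B \<boxtimes> pr2 D E"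
proof -
  have "pr2 D (B \<otimes> E) \<cdot> swap_mid_inner B D E
      = (pr2 D (B \<otimes> E) \<cdot> assoc C D B E) \<cdot> (swap C B D \<boxtimes> Id C E) \<cdot> assoc' C B D E"
    by simp
  also have "\<dots> = ((pr2 D B \<boxtimes> Id C E) \<cdot> (swap C B D \<boxtimes> Id C E)) \<cdot> assoc' C B D E"
    unfolding pr2_assoc by simp
  also have "\<dots> = (pr1 B D \<boxtimes> Id C E) \<cdot> assoc' C B D E"
    by (subst tensor_comp) (simp_all add: pr2_swap)
  also have "\<dots> = Id C B \<boxtimes> pr2 D E"
    by (rule comp_assoc'_eqI [OF pr2_pr1_assoc]) simp
  finally show ?thesis .
qed

lemma pr2_pr2_swap_mid_inner: "(Id C D \<boxtimes> pr2 B E) \<cdot> swap_mid_inner B D E = pr2 B (D \<otimes> E)"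
proof -
  have "(Id C D \<boxtimes> pr2 B E) \<cdot> swap_mid_inner B D E
      = ((Id C D \<boxtimes> pr2 B E) \<cdot> assoc C D B E) \<cdot> (swap C B D \<boxtimes> Id C E) \<cdot> assoc' C B D E"
    by simp
  also have "\<dots> = ((pr1 D B \<boxtimes> Id C E) \<cdot> (swap C B D \<boxtimes> Id C E)) \<cdot> assoc' C B D E"
    unfolding pr2_pr1_assoc by simp
  also have "\<dots> = (pr2 B D \<boxtimes> Id C E) \<cdot> assoc' C B D E"
    by (subst tensor_comp) (simp_all add: pr1_swap)
  also have "\<dots> = pr2 B (D \<otimes> E)"
    by (rule comp_assoc'_eqI [OF pr2_assoc]) simp
  finally show ?thesis .
qed

lemma Dom_Cod_swap_middle [simp]:
  "Dom C (swap_middle C A B D E) = (A \<otimes> B) \<otimes> (D \<otimes> E)"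
  "Cod C (swap_middle C A B D E) = (A \<otimes> D) \<otimes> (B \<otimes> E)"
  by (simp_all add: swap_middle_def)

text \<open>\<open>h\<close> is left arbitrary so that both projections of
  \<open>B \<otimes> E\<close> are covered.\<close>

lemma pr1_swap_middle:
  assumes "Dom C h = B \<otimes> E"
  shows "(pr1 A D \<boxtimes> h) \<cdot> swap_middle C A B D E = (Id C A \<boxtimes> (h \<cdot> (Id C B \<boxtimes> pr2 D E))) \<cdot> assoc C A B (D \<otimes> E)"
proof -
  have "(pr1 A D \<boxtimes> h) \<cdot> swap_middle C A B D E =
     (Id C A \<boxtimes> h) \<cdot> ((pr1 A D \<boxtimes> Id C (B \<otimes> E)) \<cdot> assoc' C A D (B \<otimes> E)) \<cdot>
       (Id C A \<boxtimes> swap_mid_inner B D E) \<cdot> assoc C A B (D \<otimes> E)"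
    using assms by (simp flip: comp_assoc add: tensor_comp swap_middle_def)
  also have "(pr1 A D \<boxtimes> Id C (B \<otimes> E)) \<cdot> assoc' C A D (B \<otimes> E) = Id C A \<boxtimes> pr2 D (B \<otimes> E)"
    by (rule comp_assoc'_eqI [OF pr2_pr1_assoc]) simp
  also have "(Id C A \<boxtimes> h) \<cdot> (Id C A \<boxtimes> pr2 D (B \<otimes> E)) \<cdot> (Id C A \<boxtimes> swap_mid_inner B D E) \<cdot> assoc C A B (D \<otimes> E)
      = (Id C A \<boxtimes> (h \<cdot> (pr2 D (B \<otimes> E) \<cdot> swap_mid_inner B D E))) \<cdot> assoc C A B (D \<otimes> E)"
    using assms by (simp flip: comp_assoc add: tensor_comp)
  finally show ?thesis unfolding pr2_swap_mid_inner .
qed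

text \<open>Through \<open>copy_tensor\<close>, this evaluation shows that the two projections pair
  to the identity; the two evaluations below show that projections commute with copying.\<close>

lemma pr1_pr2_swap_middle: "(pr1 A D \<boxtimes> pr2 B E) \<cdot> swap_middle C A B D E = pr1 A B \<boxtimes> pr2 D E"
proof -
  have "(pr1 A D \<boxtimes> pr2 B E) \<cdot> swap_middle C A B D E
      = (Id C A \<boxtimes> (pr2 D E \<cdot> pr2 B (D \<otimes> E))) \<cdot> assoc C A B (D \<otimes> E)"
    by (simp add: pr1_swap_middle pr2_tensor)
  also have "\<dots> = (Id C A \<boxtimes> pr2 D E) \<cdot> ((Id C A \<boxtimes> pr2 B (D \<otimes> E)) \<cdot> assoc C A B (D \<otimes> E))"
    by (simp flip: comp_assoc add: tensor_comp)
  finally show ?thesis unfolding pr2_pr1_assoc by (simp add: tensor_comp)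
qed

lemma pr1_pr1_swap_middle: "(pr1 A D \<boxtimes> pr1 B E) \<cdot> swap_middle C A B D E = pr1 (A \<otimes> B) (D \<otimes> E)"
  by (simp add: pr1_swap_middle pr1_tensor pr1_assoc)

lemma pr2_pr2_swap_middle: "(pr2 A D \<boxtimes> pr2 B E) \<cdot> swap_middle C A B D E = pr2 (A \<otimes> B) (D \<otimes> E)"
proof -
  let ?k = "swap_mid_inner B D E"
  have "(pr2 A D \<boxtimes> pr2 B E) \<cdot> swap_middle C A B D E =
     (Id C D \<boxtimes> pr2 B E) \<cdot> ((pr2 A D \<boxtimes> Id C (B \<otimes> E)) \<cdot> assoc' C A D (B \<otimes> E)) \<cdot>
       (Id C A \<boxtimes> ?k) \<cdot> assoc C A B (D \<otimes> E)"
    by (simp flip: comp_assoc add: tensor_comp swap_middle_def)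
  also have "(pr2 A D \<boxtimes> Id C (B \<otimes> E)) \<cdot> assoc' C A D (B \<otimes> E) = pr2 A (D \<otimes> (B \<otimes> E))"
    by (rule comp_assoc'_eqI [OF pr2_assoc]) simp
  also have "(Id C D \<boxtimes> pr2 B E) \<cdot> pr2 A (D \<otimes> (B \<otimes> E)) \<cdot> (Id C A \<boxtimes> ?k) \<cdot> assoc C A B (D \<otimes> E)
      = (Id C D \<boxtimes> pr2 B E) \<cdot> (pr2 A (D \<otimes> (B \<otimes> E)) \<cdot> (Id C A \<boxtimes> ?k)) \<cdot> assoc C A B (D \<otimes> E)"
    by simp
  also have "\<dots> = (Id C D \<boxtimes> pr2 B E) \<cdot> (?k \<cdot> pr2 A (B \<otimes> (D \<otimes> E))) \<cdot> assoc C A B (D \<otimes> E)"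
    by (subst pr2_tensor) simp_all
  also have "\<dots> = ((Id C D \<boxtimes> pr2 B E) \<cdot> ?k) \<cdot> (pr2 A (B \<otimes> (D \<otimes> E)) \<cdot> assoc C A B (D \<otimes> E))"
    by simp
  also have "\<dots> = pr2 (A \<otimes> B) (D \<otimes> E)"
    unfolding pr2_pr2_swap_mid_inner pr2_assoc by (simp add: pr2_tensor)
  finally show ?thesis .
qed

section \<open>Pairing and deterministic morphisms\<close>

definition pair :: "'b \<Rightarrow> 'b \<Rightarrow> 'b" ("\<langle>_,/ _\<rangle>") where
  "\<langle>f, g\<rangle> = (f \<boxtimes> g) \<cdot> copy C (Dom C f)"

text \<open>Deterministic means being a comonoid homomorphism; compatibility with \<open>del\<close>
  is automatic because the unit is terminal.\<close>

definition det :: "'b \<Rightarrow> bool" where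
  "det f \<longleftrightarrow> copy C (Cod C f) \<cdot> f = \<langle>f, f\<rangle>"

lemma Dom_Cod_pair [simp]:
  assumes "Dom C f = Dom C g"
  shows "Dom C \<langle>f, g\<rangle> = Dom C g" "Cod C \<langle>f, g\<rangle> = Cod C f \<otimes> Cod C g"
  using assms by (simp_all add: pair_def)

lemma tensor_pair:
  "\<lbrakk>Cod C f = Dom C a; Cod C g = Dom C b; Dom C f = Dom C g\<rbrakk> \<Longrightarrow> (a \<boxtimes> b) \<cdot> \<langle>f, g\<rangle> = \<langle>a \<cdot> f, b \<cdot> g\<rangle>"
  by (simp flip: comp_assoc add: pair_def tensor_comp)

lemma copy_eq_pair: "copy C A = \<langle>Id C A, Id C A\<rangle>"
  by (simp add: pair_def)

lemma copy_comp_det: "\<lbrakk>det f; A = Cod C f\<rbrakk> \<Longrightarrow> copy C A \<cdot> f = \<langle>f, f\<rangle>"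
  by (simp add: det_def)

lemma pair_comp_det:
  assumes "det d" "Dom C f = Cod C d" "Dom C g = Cod C d"
  shows "\<langle>f, g\<rangle> \<cdot> d = \<langle>f \<cdot> d, g \<cdot> d\<rangle>"
proof -
  have "\<langle>f, g\<rangle> \<cdot> d = (f \<boxtimes> g) \<cdot> \<langle>d, d\<rangle>"
    using assms by (simp add: pair_def [of f g] copy_comp_det)
  then show ?thesis using assms by (simp add: tensor_pair)
qed

text \<open>Coassociativity of \<open>copy\<close>, transported by naturality of the associator. The
  components may be random, as all three read copies of the same input.\<close>

lemma assoc_pair:
  assumes "Dom C f = Dom C h" "Dom C g = Dom C h" "A = Cod C f" "B = Cod C g" "D = Cod C h"
  shows "assoc C A B D \<cdot> \<langle>\<langle>f, g\<rangle>, h\<rangle> = \<langle>f, \<langle>g, h\<rangle>\<rangle>"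
proof -
  let ?W = "Dom C h"
  have "\<langle>\<langle>f, g\<rangle>, h\<rangle> = ((f \<boxtimes> g) \<boxtimes> h) \<cdot> (copy C ?W \<boxtimes> Id C ?W) \<cdot> copy C ?W"
    using assms by (simp flip: comp_assoc add: pair_def tensor_comp)
  then have "assoc C A B D \<cdot> \<langle>\<langle>f, g\<rangle>, h\<rangle> =
      (assoc C A B D \<cdot> ((f \<boxtimes> g) \<boxtimes> h)) \<cdot> (copy C ?W \<boxtimes> Id C ?W) \<cdot> copy C ?W"
    using assms by simp
  also have "\<dots> = (f \<boxtimes> (g \<boxtimes> h)) \<cdot> assoc C ?W ?W ?W \<cdot> (copy C ?W \<boxtimes> Id C ?W) \<cdot> copy C ?W"
    using assms by (simp add: assoc_nat)
  also have "\<dots> = (f \<boxtimes> (g \<boxtimes> h)) \<cdot> (Id C ?W \<boxtimes> copy C ?W) \<cdot> copy C ?W"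
    by (simp only: copy_coassoc)
  also have "\<dots> = \<langle>f, \<langle>g, h\<rangle>\<rangle>"
    using assms by (simp flip: comp_assoc add: pair_def tensor_comp)
  finally show ?thesis .
qed

lemma assoc'_pair:
  assumes "Dom C f = Dom C h" "Dom C g = Dom C h" "A = Cod C f" "B = Cod C g" "D = Cod C h"
  shows "assoc' C A B D \<cdot> \<langle>f, \<langle>g, h\<rangle>\<rangle> = \<langle>\<langle>f, g\<rangle>, h\<rangle>"
proof -
  have "assoc' C A B D \<cdot> \<langle>f, \<langle>g, h\<rangle>\<rangle> = (assoc' C A B D \<cdot> assoc C A B D) \<cdot> \<langle>\<langle>f, g\<rangle>, h\<rangle>"
    using assms by (simp add: assoc_pair del: assoc_iso)
  then show ?thesis using assms by simp
qed

lemma swap_pair: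
  assumes "Dom C f = Dom C g" "A = Cod C f" "B = Cod C g"
  shows "swap C A B \<cdot> \<langle>f, g\<rangle> = \<langle>g, f\<rangle>"
proof -
  have "swap C A B \<cdot> \<langle>f, g\<rangle> = (swap C A B \<cdot> (f \<boxtimes> g)) \<cdot> copy C (Dom C g)"
    using assms by (simp add: pair_def)
  also have "\<dots> = (g \<boxtimes> f) \<cdot> swap C (Dom C g) (Dom C g) \<cdot> copy C (Dom C g)"
    using assms by (simp add: swap_nat)
  finally show ?thesis using assms by (simp add: copy_comm pair_def)
qed

lemma pr1_pair:
  assumes "Dom C f = Dom C g" "A = Cod C f" "B = Cod C g"
  shows "pr1 A B \<cdot> \<langle>f, g\<rangle> = f"
proof -
  have "pr1 A B \<cdot> \<langle>f, g\<rangle> = (pr1 A B \<cdot> (f \<boxtimes> g)) \<cdot> copy C (Dom C g)"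
    using assms by (simp add: pair_def)
  also have "\<dots> = f \<cdot> pr1 (Dom C g) (Dom C g) \<cdot> copy C (Dom C g)"
    using assms by (simp add: pr1_tensor)
  finally show ?thesis using assms by (simp add: copy_counit_right pr1_def)
qed

lemma pr2_pair:
  assumes "Dom C f = Dom C g" "A = Cod C f" "B = Cod C g"
  shows "pr2 A B \<cdot> \<langle>f, g\<rangle> = g"
proof -
  have "pr2 A B \<cdot> \<langle>f, g\<rangle> = (pr2 A B \<cdot> (f \<boxtimes> g)) \<cdot> copy C (Dom C g)"
    using assms by (simp add: pair_def)
  also have "\<dots> = g \<cdot> pr2 (Dom C g) (Dom C g) \<cdot> copy C (Dom C g)"
    using assms by (simp add: pr2_tensor)
  finally show ?thesis using assms by (simp add: copy_counit_left pr2_def)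
qed

lemma swap_middle_pair:
  assumes "Dom C a = Dom C e" "Dom C b = Dom C e" "Dom C d = Dom C e"
    "A = Cod C a" "B = Cod C b" "D = Cod C d" "E = Cod C e"
  shows "swap_middle C A B D E \<cdot> \<langle>\<langle>a, b\<rangle>, \<langle>d, e\<rangle>\<rangle> = \<langle>\<langle>a, d\<rangle>, \<langle>b, e\<rangle>\<rangle>"
  using assms by (simp add: swap_middle_def assoc_pair assoc'_pair swap_pair tensor_pair)

lemma pair_pr: "\<langle>pr1 A B, pr2 A B\<rangle> = Id C (A \<otimes> B)"
proof -
  have "\<langle>pr1 A B, pr2 A B\<rangle> = ((pr1 A B \<boxtimes> pr2 A B) \<cdot> swap_middle C A A B B) \<cdot> (copy C A \<boxtimes> copy C B)"
    by (simp add: pair_def copy_tensor)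
  also have "\<dots> = (pr1 A A \<cdot> copy C A) \<boxtimes> (pr2 B B \<cdot> copy C B)"
    unfolding pr1_pr2_swap_middle by (simp add: tensor_comp)
  also have "\<dots> = Id C (A \<otimes> B)"
    by (simp add: copy_eq_pair pr1_pair pr2_pair)
  finally show ?thesis .
qed

lemma det_pr [simp]: "det (pr1 A B)" "det (pr2 A B)"
proof -
  have "\<langle>pr1 A B, pr1 A B\<rangle> = ((pr1 A B \<boxtimes> pr1 A B) \<cdot> swap_middle C A A B B) \<cdot> (copy C A \<boxtimes> copy C B)"
    by (simp add: pair_def copy_tensor)
  also have "\<dots> = copy C A \<cdot> pr1 A B"
    unfolding pr1_pr1_swap_middle by (simp add: pr1_tensor)
  finally show "det (pr1 A B)" by (simp add: det_def)
  have "\<langle>pr2 A B, pr2 A B\<rangle> = ((pr2 A B \<boxtimes> pr2 A B) \<cdot> swap_middle C A A B B) \<cdot> (copy C A \<boxtimes> copy C B)"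
    by (simp add: pair_def copy_tensor)
  also have "\<dots> = copy C B \<cdot> pr2 A B"
    unfolding pr2_pr2_swap_middle by (simp add: pr2_tensor)
  finally show "det (pr2 A B)" by (simp add: det_def)
qed

lemma det_pair [simp]:
  assumes "det f" "det g" "Dom C f = Dom C g"
  shows "det \<langle>f, g\<rangle>"
proof -
  have "copy C (Cod C f \<otimes> Cod C g) \<cdot> \<langle>f, g\<rangle>
      = swap_middle C (Cod C f) (Cod C f) (Cod C g) (Cod C g) \<cdot> \<langle>\<langle>f, f\<rangle>, \<langle>g, g\<rangle>\<rangle>"
    using assms by (simp add: copy_tensor tensor_pair copy_comp_det)
  then show ?thesis using assms by (simp add: swap_middle_pair det_def)
qed

lemma det_comp [simp]: "\<lbrakk>det f; det g; Cod C f = Dom C g\<rbrakk> \<Longrightarrow> det (g \<cdot> f)"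
  by (simp flip: comp_assoc add: det_def copy_comp_det pair_comp_det)

lemma det_Id [simp]: "det (Id C A)"
  by (simp add: det_def copy_eq_pair)

text \<open>\<open>\<I> \<otimes> \<I>\<close> is isomorphic to the terminal object, hence terminal
  itself.\<close>

lemma unit_tensor_unit_unique:
  assumes "Cod C f = \<I> \<otimes> \<I>" "Cod C g = \<I> \<otimes> \<I>" "Dom C f = Dom C g"
  shows "f = g"
proof (rule iso_cancel_left [of "lunit' C \<I>" "lunit C \<I>"])
  show "lunit C \<I> \<cdot> f = lunit C \<I> \<cdot> g" using assms by (intro eq_to_unit) simp_all
qed (use assms lunit'_lunit in auto)

lemma det_del [simp]: "det (del C A)"
  unfolding det_def by (rule unit_tensor_unit_unique) simp_all

text \<open>The uniqueness half of the universal property of a product, which is where determinism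
  of \<open>f\<close> enters.\<close>

lemma eq_pair_pr: "\<lbrakk>Cod C f = A \<otimes> B; det f\<rbrakk> \<Longrightarrow> \<langle>pr1 A B \<cdot> f, pr2 A B \<cdot> f\<rangle> = f"
  using pair_comp_det [of f "pr1 A B" "pr2 A B"] by (simp add: pair_pr)

section \<open>Structure maps as tuples of projections\<close>

lemma tensor_eq_pair: "f \<boxtimes> g = \<langle>f \<cdot> pr1 (Dom C f) (Dom C g), g \<cdot> pr2 (Dom C f) (Dom C g)\<rangle>"
  using tensor_pair [of "pr1 (Dom C f) (Dom C g)" f "pr2 (Dom C f) (Dom C g)" g]
  by (simp add: pair_pr)

lemma swap_eq_pair: "swap C A B = \<langle>pr2 A B, pr1 A B\<rangle>"
  using swap_pair [of "pr1 A B" "pr2 A B"] by (simp add: pair_pr)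

lemma triple_pr:
  "\<langle>\<langle>pr1 A B \<cdot> pr1 (A \<otimes> B) D, pr2 A B \<cdot> pr1 (A \<otimes> B) D\<rangle>, pr2 (A \<otimes> B) D\<rangle> = Id C ((A \<otimes> B) \<otimes> D)"
  by (simp add: eq_pair_pr pair_pr)

lemma triple_pr':
  "\<langle>pr1 A (B \<otimes> D), \<langle>pr1 B D \<cdot> pr2 A (B \<otimes> D), pr2 B D \<cdot> pr2 A (B \<otimes> D)\<rangle>\<rangle> = Id C (A \<otimes> (B \<otimes> D))"
  by (simp add: eq_pair_pr pair_pr)

lemma assoc_eq_pair:
  "assoc C A B D = \<langle>pr1 A B \<cdot> pr1 (A \<otimes> B) D, \<langle>pr2 A B \<cdot> pr1 (A \<otimes> B) D, pr2 (A \<otimes> B) D\<rangle>\<rangle>"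
  using assoc_pair [of "pr1 A B \<cdot> pr1 (A \<otimes> B) D" "pr2 (A \<otimes> B) D" "pr2 A B \<cdot> pr1 (A \<otimes> B) D" A B D]
  by (simp add: triple_pr)

lemma assoc'_eq_pair:
  "assoc' C A B D = \<langle>\<langle>pr1 A (B \<otimes> D), pr1 B D \<cdot> pr2 A (B \<otimes> D)\<rangle>, pr2 B D \<cdot> pr2 A (B \<otimes> D)\<rangle>"
  using assoc'_pair [of "pr1 A (B \<otimes> D)" "pr2 B D \<cdot> pr2 A (B \<otimes> D)" "pr1 B D \<cdot> pr2 A (B \<otimes> D)" A B D]
  by (simp add: triple_pr')

lemma del_unit: "del C \<I> = Id C \<I>"
  by (rule eq_to_unit) simp_all

lemma lunit_eq_pr: "lunit C A = pr2 \<I> A"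
  by (simp add: pr2_def del_unit)

lemma runit_eq_pr: "runit C A = pr1 A \<I>"
  by (simp add: pr1_def del_unit)

lemma lunit'_eq_pair: "lunit' C A = \<langle>del C A, Id C A\<rangle>"
proof (rule iso_cancel_left [of "lunit' C A" "lunit C A"])
  show "lunit C A \<cdot> lunit' C A = lunit C A \<cdot> \<langle>del C A, Id C A\<rangle>"
    by (subst (2) lunit_eq_pr) (simp add: pr2_pair lunit_lunit')
qed (auto simp: lunit'_lunit)

lemma runit'_eq_pair: "runit' C A = \<langle>Id C A, del C A\<rangle>"
proof (rule iso_cancel_left [of "runit' C A" "runit C A"])
  show "runit C A \<cdot> runit' C A = runit C A \<cdot> \<langle>Id C A, del C A\<rangle>"
    by (subst (2) runit_eq_pr) (simp add: pr1_pair runit_runit')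
qed (auto simp: runit'_runit)

lemma det_tensor [simp]: "\<lbrakk>det f; det g\<rbrakk> \<Longrightarrow> det (f \<boxtimes> g)"
  by (simp add: tensor_eq_pair)

lemma det_structure [simp]:
  "det (swap C A B)" "det (assoc C A B D)" "det (assoc' C A B D)" "det (lunit C A)" "det (runit C A)"
  "det (lunit' C A)" "det (runit' C A)" "det (copy C A)"
  by (simp_all add: swap_eq_pair assoc_eq_pair assoc'_eq_pair lunit_eq_pr runit_eq_pr
      lunit'_eq_pair runit'_eq_pair copy_eq_pair)

text \<open>\<open>f\<close> may be random here, so \<open>pair_comp_det\<close> is no substitute;
  the identity survives because one of the two copies is deleted.\<close>

lemma lunit'_comp: "A = Cod C f \<Longrightarrow> lunit' C A \<cdot> f = \<langle>del C (Dom C f), f\<rangle>"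
proof (rule iso_cancel_left [of "lunit' C A" "lunit C A"])
  assume A: "A = Cod C f"
  then have "lunit C A \<cdot> lunit' C A \<cdot> f = f"
    by (subst comp_assoc [symmetric]) (simp_all add: lunit_lunit')
  then show "lunit C A \<cdot> lunit' C A \<cdot> f = lunit C A \<cdot> \<langle>del C (Dom C f), f\<rangle>"
    using A by (simp add: lunit_eq_pr pr2_pair)
qed (auto simp: lunit'_lunit)

text \<open>Compositions are normalized to the right, which hides the left-hand sides of the pairing
  rules whenever a further morphism \<open>k\<close> follows; each rule is therefore repeated with
  such a tail.\<close>

lemma tensor_pair_comp:
  assumes "Cod C f = Dom C a" "Cod C g = Dom C b" "Dom C f = Dom C g" "Cod C k = Dom C g"
  shows "(a \<boxtimes> b) \<cdot> \<langle>f, g\<rangle> \<cdot> k = \<langle>a \<cdot> f, b \<cdot> g\<rangle> \<cdot> k"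
  by (rule comp_reduce [OF tensor_pair]) (use assms in simp_all)

lemma pair_comp_det_comp:
  assumes "det d" "Dom C f = Cod C d" "Dom C g = Cod C d" "Cod C k = Dom C d"
  shows "\<langle>f, g\<rangle> \<cdot> d \<cdot> k = \<langle>f \<cdot> d, g \<cdot> d\<rangle> \<cdot> k"
  by (rule comp_reduce [OF pair_comp_det]) (use assms in simp_all)

lemma assoc_pair_comp:
  assumes "Dom C f = Dom C h" "Dom C g = Dom C h" "A = Cod C f" "B = Cod C g" "D = Cod C h" "Cod C k = Dom C h"
  shows "assoc C A B D \<cdot> \<langle>\<langle>f, g\<rangle>, h\<rangle> \<cdot> k = \<langle>f, \<langle>g, h\<rangle>\<rangle> \<cdot> k"
  by (rule comp_reduce [OF assoc_pair]) (use assms in simp_all)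

lemma assoc'_pair_comp:
  assumes "Dom C f = Dom C h" "Dom C g = Dom C h" "A = Cod C f" "B = Cod C g" "D = Cod C h" "Cod C k = Dom C h"
  shows "assoc' C A B D \<cdot> \<langle>f, \<langle>g, h\<rangle>\<rangle> \<cdot> k = \<langle>\<langle>f, g\<rangle>, h\<rangle> \<cdot> k"
  using comp_reduce [OF assoc'_pair [of f h g]] assms by simp

lemma swap_pair_comp:
  assumes "Dom C f = Dom C g" "A = Cod C f" "B = Cod C g" "Cod C k = Dom C g"
  shows "swap C A B \<cdot> \<langle>f, g\<rangle> \<cdot> k = \<langle>g, f\<rangle> \<cdot> k"
  by (rule comp_reduce [OF swap_pair]) (use assms in simp_all)

lemma pr1_pair_comp:
  assumes "Dom C f = Dom C g" "A = Cod C f" "B = Cod C g" "Cod C k = Dom C g"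
  shows "pr1 A B \<cdot> \<langle>f, g\<rangle> \<cdot> k = f \<cdot> k"
  by (rule comp_reduce [OF pr1_pair]) (use assms in simp_all)

lemma pr2_pair_comp:
  assumes "Dom C f = Dom C g" "A = Cod C f" "B = Cod C g" "Cod C k = Dom C g"
  shows "pr2 A B \<cdot> \<langle>f, g\<rangle> \<cdot> k = g \<cdot> k"
  by (rule comp_reduce [OF pr2_pair]) (use assms in simp_all)

lemmas pair_simps = tensor_pair assoc_pair assoc'_pair swap_pair pr1_pair pr2_pair
  tensor_pair_comp assoc_pair_comp assoc'_pair_comp swap_pair_comp pr1_pair_comp pr2_pair_comp

lemmas pair_det_simps = pair_comp_det pair_comp_det_comp pair_pr

text \<open>The right-hand side uses \<open>a\<close> once, next to a copy of \<open>Z\<close>, and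
  then only reorders. In this form the map can be composed with
  \<open>\<langle>f, Id C Z\<rangle>\<close> for a random \<open>f\<close>, which is never
  copied.\<close>

lemma pair_pr2_eq:
  assumes "Dom C a = Z"
  shows "\<langle>a \<cdot> pr2 B Z, Id C (B \<otimes> Z)\<rangle> =
    assoc C (Cod C a) B Z \<cdot> (swap C B (Cod C a) \<boxtimes> Id C Z) \<cdot> assoc' C B (Cod C a) Z \<cdot> (Id C B \<boxtimes> \<langle>a, Id C Z\<rangle>)"
proof -
  have "Id C B \<boxtimes> \<langle>a, Id C Z\<rangle> = \<langle>pr1 B Z, \<langle>a \<cdot> pr2 B Z, pr2 B Z\<rangle>\<rangle>"
    using assms by (simp add: tensor_eq_pair pair_comp_det)
  then show ?thesis using assms by (simp add: pair_simps pair_pr)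
qed

lemma pair_pr2_pair:
  assumes "Dom C a = Z" "Dom C f = Z"
  shows "\<langle>a \<cdot> pr2 (Cod C f) Z, Id C (Cod C f \<otimes> Z)\<rangle> \<cdot> \<langle>f, Id C Z\<rangle> = \<langle>a, \<langle>f, Id C Z\<rangle>\<rangle>"
  using assms by (simp add: pair_pr2_eq pair_simps)

section \<open>Conditional independence of variables on a sample space\<close>

text \<open>
  A variable is a deterministic morphism out of \<open>Cod w\<close>. With conditionals, \<open>u \<bottom> v | z\<close> is equivalent
  to \<open>generated w u \<langle>v, z\<rangle> z\<close>; this asymmetric form makes the separoid axioms easy to check.
\<close>

definition cond_indep :: "'b \<Rightarrow> 'b \<Rightarrow> 'b \<Rightarrow> 'b \<Rightarrow> bool" where
  "cond_indep w u v z \<longleftrightarrow> (\<exists>a \<in> hom C (Cod C z) (Cod C u). \<exists>b \<in> hom C (Cod C z) (Cod C v).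
     \<langle>u, \<langle>v, z\<rangle>\<rangle> \<cdot> w = \<langle>a, \<langle>b, Id C (Cod C z)\<rangle>\<rangle> \<cdot> z \<cdot> w)"

definition generated :: "'b \<Rightarrow> 'b \<Rightarrow> 'b \<Rightarrow> 'b \<Rightarrow> bool" where
  "generated w u k z \<longleftrightarrow> (\<exists>a \<in> hom C (Cod C z) (Cod C u). \<langle>u, k\<rangle> \<cdot> w = \<langle>a \<cdot> z, k\<rangle> \<cdot> w)"

lemma generatedI:
  "\<lbrakk>Dom C a = Cod C z; Cod C a = Cod C u; \<langle>u, k\<rangle> \<cdot> w = \<langle>a \<cdot> z, k\<rangle> \<cdot> w\<rbrakk> \<Longrightarrow> generated w u k z"
  unfolding generated_def by (rule bexI [of _ a]) (assumption, simp add: hom_iff)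

lemma cond_indepI:
  "\<lbrakk>Dom C a = Cod C z; Cod C a = Cod C u; Dom C b = Cod C z; Cod C b = Cod C v;
    \<langle>u, \<langle>v, z\<rangle>\<rangle> \<cdot> w = \<langle>a, \<langle>b, Id C (Cod C z)\<rangle>\<rangle> \<cdot> z \<cdot> w\<rbrakk> \<Longrightarrow> cond_indep w u v z"
  unfolding cond_indep_def by (rule bexI [of _ a], rule bexI [of _ b]) (assumption, simp_all add: hom_iff)

text \<open>Decomposition and weak union at once: \<open>e\<close> and \<open>h\<close> shrink
  \<open>u\<close> and \<open>k\<close>, while \<open>g\<close> recovers \<open>z\<close> from the
  richer \<open>z'\<close>. The new kernel is \<open>e \<cdot> a \<cdot> g\<close>.\<close>

lemma generated_mono:
  assumes "generated w u k z" "Cod C u = Dom C e" "Cod C k = Dom C h" "Cod C z' = Dom C g" "z = g \<cdot> z'"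
    "Dom C u = Cod C w" "Dom C k = Cod C w" "Dom C z' = Cod C w"
  shows "generated w (e \<cdot> u) (h \<cdot> k) z'"
proof -
  obtain a where a: "Dom C a = Cod C z" "Cod C a = Cod C u" "\<langle>u, k\<rangle> \<cdot> w = \<langle>a \<cdot> z, k\<rangle> \<cdot> w"
    using assms(1) by (auto simp: generated_def hom_iff)
  have "(e \<boxtimes> h) \<cdot> \<langle>u, k\<rangle> \<cdot> w = (e \<boxtimes> h) \<cdot> \<langle>a \<cdot> z, k\<rangle> \<cdot> w"
    using a by simp
  then have "\<langle>e \<cdot> u, h \<cdot> k\<rangle> \<cdot> w = \<langle>(e \<cdot> a \<cdot> g) \<cdot> z', h \<cdot> k\<rangle> \<cdot> w"
    using assms(2-) a(1,2) by (simp add: pair_simps)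
  then show ?thesis
    by (rule generatedI [rotated -1]) (use assms(2-5) a(1,2) in simp_all)
qed

text \<open>The defining equation is symmetric up to the permutation \<open>?s\<close>; this axiom
  is the reason to keep the symmetric form beside \<open>generated\<close>.\<close>

lemma cond_indep_sym:
  assumes "cond_indep w u v z" "Dom C u = Cod C w" "Dom C v = Cod C w" "Dom C z = Cod C w"
  shows "cond_indep w v u z"
proof -
  obtain a b where a: "Dom C a = Cod C z" "Cod C a = Cod C u" "Dom C b = Cod C z" "Cod C b = Cod C v"
    and eq: "\<langle>u, \<langle>v, z\<rangle>\<rangle> \<cdot> w = \<langle>a, \<langle>b, Id C (Cod C z)\<rangle>\<rangle> \<cdot> z \<cdot> w"
    using assms(1) by (auto simp: cond_indep_def hom_iff)
  let ?s = "assoc C (Cod C v) (Cod C u) (Cod C z) \<cdot> (swap C (Cod C u) (Cod C v) \<boxtimes> Id C (Cod C z)) \<cdot> assoc' C (Cod C u) (Cod C v) (Cod C z)"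
  have "?s \<cdot> \<langle>u, \<langle>v, z\<rangle>\<rangle> \<cdot> w = ?s \<cdot> \<langle>a, \<langle>b, Id C (Cod C z)\<rangle>\<rangle> \<cdot> z \<cdot> w"
    using eq by simp
  then have "\<langle>v, \<langle>u, z\<rangle>\<rangle> \<cdot> w = \<langle>b, \<langle>a, Id C (Cod C z)\<rangle>\<rangle> \<cdot> z \<cdot> w"
    using assms a by (simp add: pair_simps)
  then show ?thesis
    by (rule cond_indepI [rotated -1]) (use a in simp_all)
qed

end

locale markov_category_with_conditionals = markov_category +
  assumes conditionals: "has_conditionals C"
begin

text \<open>The case \<open>A = \<I>\<close> of conditionals, with the input
  \<open>\<I> \<otimes> X\<close> of the conditional replaced by \<open>X\<close> along the left
  unitor.\<close>

lemma state_conditional: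
  assumes "Dom C f = \<I>" "Cod C f = X \<otimes> Y"
  obtains c where "Dom C c = X" "Cod C c = Y" "f = \<langle>Id C X, c\<rangle> \<cdot> pr1 X Y \<cdot> f"
proof -
  let ?fX = "pr1 X Y \<cdot> f"
  let ?s = "assoc C X \<I> X \<cdot> (swap C \<I> X \<boxtimes> Id C X) \<cdot> assoc' C \<I> X X"
  have "f \<in> hom C \<I> (X \<otimes> Y)" using assms by (simp add: hom_iff)
  then obtain c where c: "Dom C c = \<I> \<otimes> X" "Cod C c = Y"
    and eq: "f = (Id C X \<boxtimes> c) \<cdot> ?s \<cdot> (Id C \<I> \<boxtimes> copy C X) \<cdot> (Id C \<I> \<boxtimes> ?fX) \<cdot> copy C \<I>"
    using conditionals assms unfolding has_conditionals_def Let_def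
    by (force simp: hom_iff pr1_def)
  have *: "copy C \<I> = lunit' C \<I>" by (rule unit_tensor_unit_unique) simp_all
  have "(Id C \<I> \<boxtimes> ?fX) \<cdot> copy C \<I> = lunit' C X \<cdot> ?fX"
    using assms by (simp add: copy_eq_pair lunit'_comp pair_simps del_unit)
  then have "f = (Id C X \<boxtimes> c) \<cdot> ?s \<cdot> (Id C \<I> \<boxtimes> copy C X) \<cdot> lunit' C X \<cdot> ?fX"
    using eq by simp
  also have "\<dots> = \<langle>Id C X, c \<cdot> lunit' C X\<rangle> \<cdot> ?fX"
    using assms c by (simp add: lunit'_eq_pair pair_simps copy_eq_pair pair_det_simps)
  finally show thesis using that [of "c \<cdot> lunit' C X"] c by simp
qed

lemma disintegrate:
  assumes "Dom C w = \<I>" "Dom C s = Cod C w" "Dom C k = Cod C w"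
  obtains c where "Dom C c = Cod C s" "Cod C c = Cod C k" "\<langle>s, k\<rangle> \<cdot> w = \<langle>Id C (Cod C s), c\<rangle> \<cdot> s \<cdot> w"
proof -
  obtain c where "Dom C c = Cod C s" "Cod C c = Cod C k"
    "\<langle>s, k\<rangle> \<cdot> w = \<langle>Id C (Cod C s), c\<rangle> \<cdot> pr1 (Cod C s) (Cod C k) \<cdot> \<langle>s, k\<rangle> \<cdot> w"
    using state_conditional [of "\<langle>s, k\<rangle> \<cdot> w" "Cod C s" "Cod C k"] assms by auto
  then show thesis using that assms by (simp add: pair_simps)
qed

text \<open>\<open>\<langle>s, k\<rangle> \<cdot> w\<close> is obtained from \<open>s \<cdot> w\<close> by a kernel producing \<open>k\<close> from \<open>s\<close> alone, so \<open>k\<close> can be adjoined to \<open>eq\<close>.\<close>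

lemma almost_sure_extend:
  assumes "Dom C w = \<I>" "Dom C s = Cod C w" "Dom C k = Cod C w" "det s"
    "Dom C a = Cod C s" "Dom C b = Cod C s" "Cod C a = Cod C b"
    and eq: "\<langle>a \<cdot> s, s\<rangle> \<cdot> w = \<langle>b \<cdot> s, s\<rangle> \<cdot> w"
  shows "\<langle>a \<cdot> s, k\<rangle> \<cdot> w = \<langle>b \<cdot> s, k\<rangle> \<cdot> w"
proof -
  obtain c where c: "Dom C c = Cod C s" "Cod C c = Cod C k" "\<langle>s, k\<rangle> \<cdot> w = \<langle>Id C (Cod C s), c\<rangle> \<cdot> s \<cdot> w"
    using disintegrate assms by metis
  have *: "\<langle>e \<cdot> s, k\<rangle> \<cdot> w = (Id C (Cod C e) \<boxtimes> c) \<cdot> \<langle>e \<cdot> s, s\<rangle> \<cdot> w" if "Dom C e = Cod C s" for e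
  proof -
    have "\<langle>e \<cdot> s, k\<rangle> \<cdot> w = (e \<boxtimes> Id C (Cod C k)) \<cdot> \<langle>s, k\<rangle> \<cdot> w"
      using that assms by (simp add: pair_simps)
    also have "\<dots> = (e \<boxtimes> Id C (Cod C k)) \<cdot> \<langle>Id C (Cod C s), c\<rangle> \<cdot> s \<cdot> w"
      using c by simp
    also have "\<dots> = (Id C (Cod C e) \<boxtimes> c) \<cdot> \<langle>e, Id C (Cod C s)\<rangle> \<cdot> s \<cdot> w"
      using that c assms by (simp add: pair_simps)
    \<comment> \<open>Determinism of \<open>s\<close> allows it to be moved into both components of
      \<open>\<langle>e, Id C (Cod C s)\<rangle>\<close>.\<close>
    finally show ?thesis using that c assms by (simp add: pair_det_simps)
  qed
  show ?thesis using * [of a] * [of b] assms by simp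
qed

text \<open>Contraction. The kernel \<open>a\<close> of \<open>s\<close> is correct jointly with
  \<open>k\<close>, the kernel \<open>b\<close> of \<open>z\<close> only jointly with
  \<open>s\<close>. Both produce \<open>u\<close> jointly with \<open>s\<close>, so \<open>a\<close>
  and \<open>b \<cdot> h\<close> agree almost surely; \<open>almost_sure_extend\<close> adjoins
  \<open>k\<close> and \<open>b\<close> takes the place of \<open>a\<close>.\<close>

lemma generated_trans:
  assumes "generated w u k s" "generated w u s z" "z = h \<cdot> s" "Cod C s = Dom C h"
    "s = g \<cdot> k" "Cod C k = Dom C g"
    "Dom C w = \<I>" "Dom C k = Cod C w" "Dom C u = Cod C w" "det s"
  shows "generated w u k z"
proof -
  obtain a where a: "Dom C a = Cod C s" "Cod C a = Cod C u" "\<langle>u, k\<rangle> \<cdot> w = \<langle>a \<cdot> s, k\<rangle> \<cdot> w"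
    using assms(1) by (auto simp: generated_def hom_iff)
  obtain b where b: "Dom C b = Cod C z" "Cod C b = Cod C u" "\<langle>u, s\<rangle> \<cdot> w = \<langle>b \<cdot> z, s\<rangle> \<cdot> w"
    using assms(2) by (auto simp: generated_def hom_iff)
  have s: "Dom C s = Cod C w" using assms by simp
  have "(Id C (Cod C u) \<boxtimes> g) \<cdot> \<langle>u, k\<rangle> \<cdot> w = (Id C (Cod C u) \<boxtimes> g) \<cdot> \<langle>a \<cdot> s, k\<rangle> \<cdot> w"
    using a by simp
  then have "\<langle>u, s\<rangle> \<cdot> w = \<langle>a \<cdot> s, s\<rangle> \<cdot> w"
    unfolding \<open>s = g \<cdot> k\<close> using assms(3-) a(1,2) s by (simp add: pair_simps)
  then have "\<langle>a \<cdot> s, s\<rangle> \<cdot> w = \<langle>(b \<cdot> h) \<cdot> s, s\<rangle> \<cdot> w"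
    using b(3) assms(1-4) b s by simp
  then have "\<langle>a \<cdot> s, k\<rangle> \<cdot> w = \<langle>(b \<cdot> h) \<cdot> s, k\<rangle> \<cdot> w"
    by (rule almost_sure_extend [rotated -1]) (use assms a b s in simp_all)
  then show ?thesis
    by (intro generatedI [of b]) (use a(1,2) a(3) b(1,2) assms(3,4) s in simp_all)
qed

text \<open>From left to right, deleting \<open>u\<close> identifies the law of
  \<open>\<langle>v, z\<rangle>\<close>, to which the kernel \<open>a\<close> is attached again.
  From right to left, the missing kernel \<open>b\<close> is a conditional of \<open>v\<close> given
  \<open>z\<close>.\<close>

lemma cond_indep_iff_generated:
  assumes "Dom C w = \<I>" "Dom C u = Cod C w" "Dom C v = Cod C w" "Dom C z = Cod C w" "det v" "det z"
  shows "cond_indep w u v z \<longleftrightarrow> generated w u \<langle>v, z\<rangle> z"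
proof
  assume "cond_indep w u v z"
  then obtain a b where a: "Dom C a = Cod C z" "Cod C a = Cod C u" "Dom C b = Cod C z" "Cod C b = Cod C v"
    and eq: "\<langle>u, \<langle>v, z\<rangle>\<rangle> \<cdot> w = \<langle>a, \<langle>b, Id C (Cod C z)\<rangle>\<rangle> \<cdot> z \<cdot> w"
    by (auto simp: cond_indep_def hom_iff)
  have "pr2 (Cod C u) (Cod C v \<otimes> Cod C z) \<cdot> \<langle>u, \<langle>v, z\<rangle>\<rangle> \<cdot> w
      = pr2 (Cod C u) (Cod C v \<otimes> Cod C z) \<cdot> \<langle>a, \<langle>b, Id C (Cod C z)\<rangle>\<rangle> \<cdot> z \<cdot> w"
    using eq by simp
  then have vz: "\<langle>v, z\<rangle> \<cdot> w = \<langle>b, Id C (Cod C z)\<rangle> \<cdot> z \<cdot> w"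
    using assms a by (simp add: pair_simps)
  have "\<langle>u, \<langle>v, z\<rangle>\<rangle> \<cdot> w = (\<langle>a \<cdot> pr2 (Cod C v) (Cod C z), Id C (Cod C v \<otimes> Cod C z)\<rangle> \<cdot> \<langle>b, Id C (Cod C z)\<rangle>) \<cdot> z \<cdot> w"
    using assms a eq pair_pr2_pair [of a "Cod C z" b] by simp
  also have "\<dots> = \<langle>a \<cdot> pr2 (Cod C v) (Cod C z), Id C (Cod C v \<otimes> Cod C z)\<rangle> \<cdot> \<langle>v, z\<rangle> \<cdot> w"
    using assms a vz by simp
  also have "\<dots> = \<langle>a \<cdot> z, \<langle>v, z\<rangle>\<rangle> \<cdot> w"
    using assms a by (simp add: pair_det_simps pair_simps)
  finally show "generated w u \<langle>v, z\<rangle> z"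
    by (rule generatedI [rotated -1]) (use a(1,2) in simp_all)
next
  assume "generated w u \<langle>v, z\<rangle> z"
  then obtain a where a: "Dom C a = Cod C z" "Cod C a = Cod C u" "\<langle>u, \<langle>v, z\<rangle>\<rangle> \<cdot> w = \<langle>a \<cdot> z, \<langle>v, z\<rangle>\<rangle> \<cdot> w"
    by (auto simp: generated_def hom_iff)
  obtain b where b: "Dom C b = Cod C z" "Cod C b = Cod C v" "\<langle>z, v\<rangle> \<cdot> w = \<langle>Id C (Cod C z), b\<rangle> \<cdot> z \<cdot> w"
    using disintegrate assms by metis
  have "swap C (Cod C z) (Cod C v) \<cdot> \<langle>z, v\<rangle> \<cdot> w = swap C (Cod C z) (Cod C v) \<cdot> \<langle>Id C (Cod C z), b\<rangle> \<cdot> z \<cdot> w"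
    using b by simp
  then have vz: "\<langle>v, z\<rangle> \<cdot> w = \<langle>b, Id C (Cod C z)\<rangle> \<cdot> z \<cdot> w"
    using assms b(1,2) by (simp add: pair_simps)
  have "\<langle>u, \<langle>v, z\<rangle>\<rangle> \<cdot> w = \<langle>a \<cdot> pr2 (Cod C v) (Cod C z), Id C (Cod C v \<otimes> Cod C z)\<rangle> \<cdot> \<langle>v, z\<rangle> \<cdot> w"
    using assms a by (simp add: pair_det_simps pair_simps)
  also have "\<dots> = (\<langle>a \<cdot> pr2 (Cod C v) (Cod C z), Id C (Cod C v \<otimes> Cod C z)\<rangle> \<cdot> \<langle>b, Id C (Cod C z)\<rangle>) \<cdot> z \<cdot> w"
    using assms a vz b by simp
  also have "\<dots> = \<langle>a, \<langle>b, Id C (Cod C z)\<rangle>\<rangle> \<cdot> z \<cdot> w"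
    using assms a b pair_pr2_pair [of a "Cod C z" b] by simp
  finally show "cond_indep w u v z"
    by (rule cond_indepI [rotated -1]) (use a(1,2) b(1,2) in simp_all)
qed

end

section \<open>Coherence for marginalizations\<close>

primrec distinct_factors :: "'l factors \<Rightarrow> bool" where
  "distinct_factors Unit \<longleftrightarrow> True"
| "distinct_factors (Factor l) \<longleftrightarrow> True"
| "distinct_factors (Tens u v) \<longleftrightarrow>
     distinct_factors u \<and> distinct_factors v \<and> set_factors u \<inter> set_factors v = {}"

text \<open>A target \<open>Tens v1 v2\<close> is reached by the rule \<open>tensor\<close> once the
  source is split in the same way. For a tensor product, the two splittings are merged by exchanging
  the middle factors.\<close>

lemma marginalization_split:
  "\<exists>u1 u2 \<phi>. marginalization C F u (Tens u1 u2) \<phi> \<and>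
     set_factors u1 = set_factors u \<inter> S \<and> set_factors u2 = set_factors u - S"
proof (induction u)
  case Unit
  show ?case
    by (rule exI [of _ Unit], rule exI [of _ Unit]) (auto intro: marginalization.lunit')
next
  case (Factor l)
  show ?case
  proof (cases "l \<in> S")
    case True
    then show ?thesis
      by (intro exI [of _ "Factor l"] exI [of _ Unit]) (auto intro: marginalization.runit')
  next
    case False
    then show ?thesis
      by (intro exI [of _ Unit] exI [of _ "Factor l"]) (auto intro: marginalization.lunit')
  qed
next
  case (Tens u v)
  obtain u1 u2 \<phi> where u: "marginalization C F u (Tens u1 u2) \<phi>"
    "set_factors u1 = set_factors u \<inter> S" "set_factors u2 = set_factors u - S"
    using Tens.IH(1) by blast
  obtain v1 v2 \<psi> where v: "marginalization C F v (Tens v1 v2) \<psi>"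
    "set_factors v1 = set_factors v \<inter> S" "set_factors v2 = set_factors v - S"
    using Tens.IH(2) by blast
  have "\<exists>\<theta>. marginalization C F (Tens u2 (Tens v1 v2)) (Tens v1 (Tens u2 v2)) \<theta>"
    by (meson marginalization.assoc' marginalization.assoc marginalization.tensor
        marginalization.swap marginalization.Id marginalization.Comp)
  then have "\<exists>\<theta>. marginalization C F (Tens (Tens u1 u2) (Tens v1 v2)) (Tens (Tens u1 v1) (Tens u2 v2)) \<theta>"
    by (meson marginalization.assoc' marginalization.assoc marginalization.tensor
        marginalization.Id marginalization.Comp)
  then have "\<exists>\<theta>. marginalization C F (Tens u v) (Tens (Tens u1 v1) (Tens u2 v2)) \<theta>"
    using u(1) v(1) by (meson marginalization.tensor marginalization.Comp)
  then show ?case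
    using u v by (intro exI [of _ "Tens u1 v1"] exI [of _ "Tens u2 v2"]) auto
qed

lemma marginalization_fst: "\<exists>\<phi>. marginalization C F (Tens u v) u \<phi>"
  and marginalization_snd: "\<exists>\<phi>. marginalization C F (Tens u v) v \<phi>"
  by (meson marginalization.Comp marginalization.tensor marginalization.Id marginalization.del
      marginalization.runit marginalization.lunit)+

text \<open>Marginalizations do not copy, which is why \<open>v\<close> has distinct labels: when
  the labels of \<open>v1\<close> have been split off, those of \<open>v2\<close> must all remain in
  the other half.\<close>

lemma marginalization_exists:
  assumes "distinct_factors v" "set_factors v \<subseteq> set_factors u"
  shows "\<exists>\<phi>. marginalization C F u v \<phi>"
  using assms
proof (induction v arbitrary: u)
  case Unit
  show ?case by (intro exI) (rule marginalization.del)
next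
  case (Factor l)
  then show ?case
  proof (induction u)
    case Unit
    then show ?case by simp
  next
    case (Factor k)
    then have "k = l" by simp
    then show ?case by (auto intro!: exI marginalization.Id)
  next
    case (Tens u1 u2)
    then consider "l \<in> set_factors u1" | "l \<in> set_factors u2" by auto
    then show ?case
    proof cases
      case 1
      then obtain \<phi> where "marginalization C F u1 (Factor l) \<phi>" using Tens.IH(1) by auto
      moreover obtain \<psi> where "marginalization C F (Tens u1 u2) u1 \<psi>"
        using marginalization_fst by fast
      ultimately show ?thesis by (intro exI) (rule marginalization.Comp)
    next
      case 2
      then obtain \<phi> where "marginalization C F u2 (Factor l) \<phi>" using Tens.IH(2) by auto
      moreover obtain \<psi> where "marginalization C F (Tens u1 u2) u2 \<psi>"
        using marginalization_snd by fast
      ultimately show ?thesis by (intro exI) (rule marginalization.Comp)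
    qed
  qed
next
  case (Tens v1 v2)
  obtain u1 u2 \<phi> where u: "marginalization C F u (Tens u1 u2) \<phi>"
    "set_factors u1 = set_factors u \<inter> set_factors v1" "set_factors u2 = set_factors u - set_factors v1"
    using marginalization_split [of C F u "set_factors v1"] by (elim exE conjE)
  have "set_factors v1 \<subseteq> set_factors u1" "set_factors v2 \<subseteq> set_factors u2"
    using Tens.prems u by auto
  then have "\<exists>\<phi>1. marginalization C F u1 v1 \<phi>1" "\<exists>\<phi>2. marginalization C F u2 v2 \<phi>2"
    using Tens by simp_all
  then obtain \<phi>1 \<phi>2 where "marginalization C F u1 v1 \<phi>1" "marginalization C F u2 v2 \<phi>2"
    by blast
  from marginalization.Comp [OF u(1) marginalization.tensor [OF this]] show ?case
    by (rule exI)
qed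

context markov_category
begin

text \<open>
  \<open>label_pr F w l\<close> is meaningful only for \<open>l \<in> set_factors w\<close>; a repeated label denotes its leftmost
  occurrence.
\<close>

primrec label_pr :: "('l \<Rightarrow> 'a) \<Rightarrow> 'l factors \<Rightarrow> 'l \<Rightarrow> 'b" where
  "label_pr F Unit l = Id C \<I>"
| "label_pr F (Factor k) l = Id C (F k)"
| "label_pr F (Tens u v) l =
     (if l \<in> set_factors u then label_pr F u l \<cdot> pr1 (obj C F u) (obj C F v)
      else label_pr F v l \<cdot> pr2 (obj C F u) (obj C F v))"

text \<open>The only candidate for a marginalization from \<open>w\<close> to \<open>v\<close> when
  \<open>w\<close> has distinct labels. In contrast to a marginalization it may read a label several
  times, which makes room for overlapping label sets.\<close>

primrec tuple :: "('l \<Rightarrow> 'a) \<Rightarrow> 'l factors \<Rightarrow> 'l factors \<Rightarrow> 'b" where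
  "tuple F w Unit = del C (obj C F w)"
| "tuple F w (Factor l) = label_pr F w l"
| "tuple F w (Tens u v) = \<langle>tuple F w u, tuple F w v\<rangle>"

lemma label_pr [simp]:
  assumes "l \<in> set_factors w"
  shows "Dom C (label_pr F w l) = obj C F w" "Cod C (label_pr F w l) = F l" "det (label_pr F w l)"
proof -
  have "Dom C (label_pr F w l) = obj C F w \<and> Cod C (label_pr F w l) = F l \<and> det (label_pr F w l)"
    using assms by (induction w) auto
  then show "Dom C (label_pr F w l) = obj C F w" "Cod C (label_pr F w l) = F l" "det (label_pr F w l)"
    by auto
qed

lemma tuple [simp]:
  assumes "set_factors v \<subseteq> set_factors w"
  shows "Dom C (tuple F w v) = obj C F w" "Cod C (tuple F w v) = obj C F v" "det (tuple F w v)"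
proof -
  have "Dom C (tuple F w v) = obj C F w \<and> Cod C (tuple F w v) = obj C F v \<and> det (tuple F w v)"
    using assms by (induction v) auto
  then show "Dom C (tuple F w v) = obj C F w" "Cod C (tuple F w v) = obj C F v" "det (tuple F w v)"
    by auto
qed

lemma label_pr_tuple:
  "\<lbrakk>l \<in> set_factors u; set_factors u \<subseteq> set_factors w\<rbrakk> \<Longrightarrow> label_pr F u l \<cdot> tuple F w u = label_pr F w l"
  by (induction u) (auto simp: pair_simps)

lemma tuple_comp:
  "\<lbrakk>set_factors v \<subseteq> set_factors u; set_factors u \<subseteq> set_factors w\<rbrakk>
    \<Longrightarrow> tuple F u v \<cdot> tuple F w u = tuple F w v"
  by (induction v) (auto simp: label_pr_tuple pair_comp_det)

lemma tuple_Tens_fst: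
  "set_factors w \<subseteq> set_factors u \<Longrightarrow> tuple F (Tens u v) w = tuple F u w \<cdot> pr1 (obj C F u) (obj C F v)"
  by (induction w) (auto simp: pair_comp_det)

lemma tuple_Tens_snd:
  "\<lbrakk>set_factors w \<subseteq> set_factors v; set_factors u \<inter> set_factors w = {}\<rbrakk>
    \<Longrightarrow> tuple F (Tens u v) w = tuple F v w \<cdot> pr2 (obj C F u) (obj C F v)"
  by (induction w) (auto simp: pair_comp_det Int_Un_distrib)

lemma tuple_self: "distinct_factors w \<Longrightarrow> tuple F w w = Id C (obj C F w)"
  by (induction w) (auto simp: tuple_Tens_fst tuple_Tens_snd pair_pr del_unit)

text \<open>Coherence by induction on the rules: every generator is a tuple of projections and
  tuples compose to tuples. Distinct labels ensure that a label of either tensor factor is read from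
  that factor.\<close>

lemma marginalization_tuple:
  assumes "marginalization C F u v \<phi>" "distinct_factors u"
  shows "distinct_factors v \<and> set_factors v \<subseteq> set_factors u \<and> \<phi> = tuple F u v"
  using assms
proof (induction rule: marginalization.induct)
  case (Comp u v \<phi> w \<psi>)
  then show ?case by (auto simp: tuple_comp)
next
  case (tensor u v \<phi> u' v' \<psi>)
  then have "set_factors u \<inter> set_factors v' = {}" by auto
  with tensor show ?case
    by (auto simp: tuple_Tens_fst tuple_Tens_snd tensor_eq_pair)
next
  case (assoc u v w)
  then show ?case
    by (auto simp: tuple_Tens_fst tuple_Tens_snd tuple_self assoc_eq_pair)
next
  case (assoc' u v w)
  then show ?case
    by (auto simp: tuple_Tens_fst tuple_Tens_snd tuple_self assoc'_eq_pair Int_Un_distrib)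
qed (auto simp: tuple_Tens_fst tuple_Tens_snd tuple_self swap_eq_pair
    lunit_eq_pr runit_eq_pr lunit'_eq_pair runit'_eq_pair)

lemma is_marginal_iff:
  assumes "distinct_factors w"
  shows "is_marginal C F w p v q \<longleftrightarrow>
    distinct_factors v \<and> set_factors v \<subseteq> set_factors w \<and> q = tuple F w v \<cdot> p"
  unfolding is_marginal_def
  using marginalization_tuple [OF _ assms] marginalization_exists by metis

lemma displays_iff_cond_indep:
  assumes "distinct_factors w" "Cod C p = obj C F w"
    "distinct_factors (Tens u (Tens v z))" "set_factors (Tens u (Tens v z)) \<subseteq> set_factors w"
  shows "displays C F w p u v z \<longleftrightarrow> cond_indep p (tuple F w u) (tuple F w v) (tuple F w z)"
proof -
  have *: "(a \<boxtimes> (b \<boxtimes> Id C Z)) \<cdot> copy3 C Z \<cdot> r = \<langle>a, \<langle>b, Id C Z\<rangle>\<rangle> \<cdot> r"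
    if "Dom C a = Z" "Dom C b = Z" "Cod C r = Z" for a b r Z
    using that by (simp add: copy3_def copy_eq_pair pair_simps)
  have "displays C F w p u v z \<longleftrightarrow>
    (\<exists>a \<in> hom C (obj C F z) (obj C F u). \<exists>b \<in> hom C (obj C F z) (obj C F v).
      tuple F w (Tens u (Tens v z)) \<cdot> p =
        (a \<boxtimes> (b \<boxtimes> Id C (obj C F z))) \<cdot> copy3 C (obj C F z) \<cdot> tuple F w z \<cdot> p)"
    using assms unfolding displays_def is_marginal_iff [OF assms(1)] by (simp add: Bex_def)
  also have "\<dots> \<longleftrightarrow> cond_indep p (tuple F w u) (tuple F w v) (tuple F w z)"
    unfolding cond_indep_def using assms by (auto simp: * hom_iff intro!: bex_cong)
  finally show ?thesis .
qed

end

section \<open>Separation in the hidden Markov tree\<close>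

text \<open>\<open>ind_mono\<close> bundles decomposition and weak union and also lets labels of
  \<open>S\<close> enter the second set. \<open>L\<close> is the set of available labels, outside of
  which the intended relation is false.\<close>

locale separoid =
  fixes L :: "'l set" and ind :: "'l set \<Rightarrow> 'l set \<Rightarrow> 'l set \<Rightarrow> bool"
  assumes ind_sym: "ind A B S \<Longrightarrow> ind B A S"
    and ind_trivial: "\<lbrakk>A \<subseteq> S; B \<union> S \<subseteq> L\<rbrakk> \<Longrightarrow> ind A B S"
    and ind_mono: "\<lbrakk>ind A B S; A' \<subseteq> A; B' \<subseteq> B \<union> S; S \<subseteq> S'; S' \<subseteq> B \<union> S\<rbrakk> \<Longrightarrow> ind A' B' S'"
    and ind_contraction: "\<lbrakk>ind A B (S \<union> D); ind A D S\<rbrakk> \<Longrightarrow> ind A (B \<union> D) S"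
begin

text \<open>\<open>ind_mono\<close> adds labels of \<open>S\<close> on the right only, hence the two
  uses around a symmetry.\<close>

lemma ind_ignore_given:
  assumes "ind (A - S) (B - S) S"
  shows "ind A B S"
proof -
  have "ind B (A - S) S"
    by (rule ind_sym, rule ind_mono [OF assms]) auto
  then show ?thesis
    by (intro ind_sym [of B A], elim ind_mono) auto
qed

text \<open>The global Markov property of a tree passes to the tree enlarged by a leaf \<open>v\<close> with neighbour \<open>q\<close>.\<close>

lemma separation_add_leaf:
  assumes sep_sym: "\<And>S a b. sep S a b \<Longrightarrow> sep S b a"
    and sep_trans: "\<And>S a b c. sep S a b \<Longrightarrow> sep S a c \<or> sep S c b"
    and sep_self: "\<And>S a. sep S a a \<Longrightarrow> a \<in> S"
    and sep_leaf: "\<And>S a. \<lbrakk>sep S v a; v \<notin> S; a \<in> V\<rbrakk> \<Longrightarrow> sep S q a"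
    and sep_del: "\<And>S a b. \<lbrakk>sep S a b; a \<in> V; b \<in> V\<rbrakk> \<Longrightarrow> sep (S - {v}) a b"
    and v: "ind {v} V {q}" "q \<in> V" "v \<notin> V"
    and IH: "\<And>A B S. \<lbrakk>A \<subseteq> V; B \<subseteq> V; S \<subseteq> V; \<And>a b. \<lbrakk>a \<in> A; b \<in> B\<rbrakk> \<Longrightarrow> sep S a b\<rbrakk> \<Longrightarrow> ind A B S"
    and ABS: "A \<subseteq> insert v V" "B \<subseteq> insert v V" "S \<subseteq> insert v V"
    and sep: "\<And>a b. \<lbrakk>a \<in> A; b \<in> B\<rbrakk> \<Longrightarrow> sep S a b"
  shows "ind A B S"
proof (rule ind_ignore_given)
  have sub: "A - S \<subseteq> insert v V" "B - S \<subseteq> insert v V" using ABS by auto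
  show "ind (A - S) (B - S) S"
  proof (cases "v \<in> S")
    case True
    \<comment> \<open>Conditioning on the leaf can only reveal something about \<open>q\<close>,
      which is harmless for a side separated from \<open>q\<close>. That side is made independent of
      \<open>q\<close> and of the other side given \<open>?S\<close>; contraction adjoins
      \<open>v\<close>, and weak union moves it into the condition.\<close>
    let ?S = "S - {v}"
    have *: "ind A' B' S"
      if A': "A' \<subseteq> V" "B' \<subseteq> V" "\<And>a b. \<lbrakk>a \<in> A'; b \<in> B'\<rbrakk> \<Longrightarrow> sep ?S a b"
        and q: "\<And>a. a \<in> A' \<Longrightarrow> sep ?S a q" for A' B'
    proof -
      have 1: "ind A' (insert q B') ?S"
        using A' q v(2) ABS by (intro IH) auto
      have "ind {v} A' (?S \<union> insert q B')"
        by (rule ind_mono [OF v(1)]) (use A' v ABS in auto)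
      then have "ind A' ({v} \<union> insert q B') ?S"
        using 1 by (intro ind_contraction ind_sym [of "{v}"])
      then show ?thesis
        by (rule ind_mono) (use True in auto)
    qed
    have AB: "A - S \<subseteq> V" "B - S \<subseteq> V" using sub True by auto
    have sep': "sep ?S a b" if "a \<in> A - S" "b \<in> B - S" for a b
      using sep sep_del AB that by blast
    show ?thesis
    proof (cases "\<forall>a \<in> A - S. sep ?S a q")
      case True
      then show ?thesis using AB sep' by (intro *) auto
    next
      case False
      \<comment> \<open>Some element of the first side is not separated from \<open>q\<close> but is
        separated from every \<open>b\<close>; transitivity leaves only separation of
        \<open>q\<close> from \<open>b\<close>.\<close>
      then have "\<forall>b \<in> B - S. sep ?S b q"
        using sep' sep_trans sep_sym by meson
      then show ?thesis
        using AB sep' sep_sym by (intro ind_sym [of "B - S"] *) auto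
    qed
  next
    case False
    then have S: "S \<subseteq> V" using ABS by auto
    have *: "ind A' B' S"
      if A': "v \<in> A'" "A' \<subseteq> insert v V" "B' \<subseteq> V" "\<And>a b. \<lbrakk>a \<in> A'; b \<in> B'\<rbrakk> \<Longrightarrow> sep S a b" for A' B'
    proof -
      \<comment> \<open>The leaf is traded for its neighbour, so that the hypothesis for
        \<open>V\<close> applies; contraction with the independence of \<open>v\<close> given
        \<open>q\<close> brings the leaf back.\<close>
      let ?A = "insert q (A' - {v})"
      have "sep S a b" if "a \<in> ?A" "b \<in> B'" for a b
        using that A' sep_leaf [OF _ False] by blast
      then have 1: "ind ?A B' S"
        using A' v S by (intro IH) auto
      have "ind {v} B' (S \<union> ?A)"
        by (rule ind_mono [OF v(1)]) (use A' v S in auto)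
      then have "ind B' ({v} \<union> ?A) S"
        using 1 by (intro ind_contraction ind_sym [of "{v}"] ind_sym [of ?A])
      then have "ind B' A' S"
        by (rule ind_mono) (use A' in auto)
      then show ?thesis by (rule ind_sym)
    qed
    have sep': "sep S a b" if "a \<in> A - S" "b \<in> B - S" for a b
      using sep that by blast
    consider "v \<in> A - S" "B - S \<subseteq> V" | "v \<in> B - S" "A - S \<subseteq> V" | "A - S \<subseteq> V" "B - S \<subseteq> V" | "v \<in> A - S" "v \<in> B - S"
      using sub by blast
    then show ?thesis
    proof cases
      case 1
      then show ?thesis using sub sep' by (intro *) auto
    next
      case 2
      then show ?thesis using sub sep' sep_sym by (intro ind_sym [of "B - S"] *) auto
    next
      case 3
      then show ?thesis using S sep' by (intro IH) auto
    next
      case 4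
      then show ?thesis using sep' sep_self False by blast
    qed
  qed
qed

end

section \<open>Separation of labels in the tree\<close>

primrec time :: "label \<Rightarrow> nat" where
  "time (X_label t) = t"
| "time (Y_label t) = t"

definition labels_before :: "nat \<Rightarrow> label set" where
  "labels_before n = X_label ` {..<n} \<union> Y_label ` {..<n}"

text \<open>A path runs through hidden vertices whose times lie between those of its ends; observed
  vertices are leaves and block only as ends. The condition \<open>a \<noteq> b\<close> keeps
  \<open>X t\<close> from separating \<open>Y t\<close> from itself.\<close>

definition separates :: "label set \<Rightarrow> label \<Rightarrow> label \<Rightarrow> bool" where
  "separates S a b \<longleftrightarrow> a \<in> S \<or> b \<in> S \<or>
     a \<noteq> b \<and> (\<exists>s. X_label s \<in> S \<and> (time a \<le> s \<and> s \<le> time b \<or> time b \<le> s \<and> s \<le> time a))"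

lemma separates_sym: "separates S a b \<Longrightarrow> separates S b a"
  by (auto simp: separates_def)

text \<open>The interval between the times of \<open>a\<close> and \<open>b\<close> is covered by
  the intervals from \<open>a\<close> to \<open>c\<close> and from \<open>c\<close> to
  \<open>b\<close>. Contrapositively, being joined by an unblocked path is transitive.\<close>

lemma separates_trans: "separates S a b \<Longrightarrow> separates S a c \<or> separates S c b"
  unfolding separates_def by (metis nle_le)

lemma separates_self: "separates S a a \<Longrightarrow> a \<in> S"
  by (auto simp: separates_def)

text \<open>A blocking index lies between the time of \<open>a\<close>, which is at most
  \<open>t\<close>, and \<open>Suc t\<close>; as it is not \<open>Suc t\<close>, it already blocks
  the way from \<open>X t\<close>.\<close>

lemma separates_leaf_X:
  "\<lbrakk>separates S (X_label (Suc t)) a; X_label (Suc t) \<notin> S; a \<in> labels_before (Suc t)\<rbrakk>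
    \<Longrightarrow> separates S (X_label t) a"
  by (auto simp: separates_def labels_before_def le_Suc_eq not_less_eq less_Suc_eq_le)

lemma separates_leaf_Y:
  "\<lbrakk>separates S (Y_label t) a; Y_label t \<notin> S\<rbrakk> \<Longrightarrow> separates S (X_label t) a"
  by (cases "a = X_label t") (auto simp: separates_def)

lemma separates_del_X:
  "\<lbrakk>separates S a b; a \<in> labels_before t; b \<in> labels_before t\<rbrakk> \<Longrightarrow> separates (S - {X_label t}) a b"
  by (auto simp: separates_def labels_before_def)

lemma separates_del_Y:
  "\<lbrakk>separates S a b; a \<noteq> Y_label t; b \<noteq> Y_label t\<rbrakk> \<Longrightarrow> separates (S - {Y_label t}) a b"
  by (auto simp: separates_def)

lemma labels_before_Suc:
  "labels_before (Suc t) = insert (Y_label t) (insert (X_label t) (labels_before t))"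
  by (auto simp: labels_before_def lessThan_Suc)

lemma labels_before_0 [simp]: "labels_before 0 = {}"
  by (simp add: labels_before_def)

lemma label_in_labels_before [simp]:
  "X_label s \<in> labels_before t \<longleftrightarrow> s < t" "Y_label s \<in> labels_before t \<longleftrightarrow> s < t"
  by (auto simp: labels_before_def)

lemma hidden_markov_separation:
  assumes "separoid L ind" and L: "labels_before (Suc n) \<subseteq> L"
    and X: "\<And>t. Suc t \<le> n \<Longrightarrow> ind {X_label (Suc t)} (labels_before (Suc t)) {X_label t}"
    and Y: "\<And>t. t \<le> n \<Longrightarrow> ind {Y_label t} (labels_before t) {X_label t}"
    and "A \<subseteq> labels_before (Suc n)" "B \<subseteq> labels_before (Suc n)" "S \<subseteq> labels_before (Suc n)"
    and "\<And>a b. \<lbrakk>a \<in> A; b \<in> B\<rbrakk> \<Longrightarrow> separates S a b"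
  shows "ind A B S"
proof -
  interpret separoid L ind by fact
  define G where "G V \<longleftrightarrow> (\<forall>A B S. A \<subseteq> V \<longrightarrow> B \<subseteq> V \<longrightarrow> S \<subseteq> V \<longrightarrow> (\<forall>a \<in> A. \<forall>b \<in> B. separates S a b) \<longrightarrow> ind A B S)"
    for V :: "label set"
  have leaf_Y: "G (labels_before (Suc t))" if "G (insert (X_label t) (labels_before t))" "t \<le> n" for t
    unfolding G_def labels_before_Suc
  proof (intro allI impI)
    fix A B S
    let ?V = "insert (X_label t) (labels_before t)"
    assume *: "A \<subseteq> insert (Y_label t) ?V" "B \<subseteq> insert (Y_label t) ?V" "S \<subseteq> insert (Y_label t) ?V"
      "\<forall>a \<in> A. \<forall>b \<in> B. separates S a b"
    show "ind A B S"
    proof (rule separation_add_leaf [OF separates_sym separates_trans separates_self, where v = "Y_label t" and q = "X_label t" and V = ?V])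
      \<comment> \<open>\<open>?V\<close> contains the condition \<open>X_label t\<close> itself,
        which \<open>ind_mono\<close> may add on the right.\<close>
      show "ind {Y_label t} ?V {X_label t}"
        by (rule ind_mono [OF Y]) (use that in auto)
      show "ind A B S" if "A \<subseteq> ?V" "B \<subseteq> ?V" "S \<subseteq> ?V" "\<And>a b. \<lbrakk>a \<in> A; b \<in> B\<rbrakk> \<Longrightarrow> separates S a b" for A B S
        using that \<open>G ?V\<close> unfolding G_def by simp
      show "separates (S - {Y_label t}) a b" if "separates S a b" "a \<in> ?V" "b \<in> ?V" for S a b
        by (rule separates_del_Y) (use that in auto)
    qed (use * separates_leaf_Y in auto)
  qed
  have leaf_X: "G (insert (X_label (Suc t)) (labels_before (Suc t)))" if "G (labels_before (Suc t))" "Suc t \<le> n" for t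
    unfolding G_def
  proof (intro allI impI)
    fix A B S
    let ?v = "X_label (Suc t)" and ?V = "labels_before (Suc t)"
    assume *: "A \<subseteq> insert ?v ?V" "B \<subseteq> insert ?v ?V" "S \<subseteq> insert ?v ?V"
      "\<forall>a \<in> A. \<forall>b \<in> B. separates S a b"
    show "ind A B S"
    proof (rule separation_add_leaf [OF separates_sym separates_trans separates_self, where v = ?v and q = "X_label t" and V = ?V])
      show "ind A B S" if "A \<subseteq> ?V" "B \<subseteq> ?V" "S \<subseteq> ?V" "\<And>a b. \<lbrakk>a \<in> A; b \<in> B\<rbrakk> \<Longrightarrow> separates S a b" for A B S
        using that \<open>G ?V\<close> unfolding G_def by simp
    qed (use * X that separates_leaf_X separates_del_X in auto)
  qed
  \<comment> \<open>In the one-vertex tree, separation of the vertex from itself puts it into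
    \<open>S\<close>; so one side is contained in \<open>S\<close> and the independence is
    trivial.\<close>
  have "G {X_label 0}"
    unfolding G_def
  proof (intro allI impI)
    fix A B S
    assume *: "A \<subseteq> {X_label 0}" "B \<subseteq> {X_label 0}" "S \<subseteq> {X_label 0}" "\<forall>a \<in> A. \<forall>b \<in> B. separates S a b"
    have "X_label 0 \<in> labels_before (Suc n)" by simp
    then have X0: "{X_label 0} \<subseteq> L" using L by blast
    have "A \<subseteq> S \<or> B \<subseteq> S"
      using * separates_self by blast
    then show "ind A B S"
      using ind_trivial [of A S B] ind_trivial [of B S A] ind_sym * X0 by blast
  qed
  then have "t \<le> n \<Longrightarrow> G (labels_before (Suc t))" for t
    by (induction t) (auto intro!: leaf_Y leaf_X)
  then have "G (labels_before (Suc n))" by simp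
  then show ?thesis using assms(5-) unfolding G_def by simp
qed

section \<open>The Markov properties\<close>

lemma factors_list_Nil [simp]: "factors_list [] = Unit"
  and factors_list_snoc [simp]: "factors_list (us @ [u]) = Tens (factors_list us) u"
  by (simp_all add: factors_list_def)

lemma set_factors_list: "set_factors (factors_list us) = (\<Union>u \<in> set us. set_factors u)"
  by (induction us rule: rev_induct) auto

lemma distinct_factors_list_map_Factor:
  "\<lbrakk>distinct xs; inj h\<rbrakk> \<Longrightarrow> distinct_factors (factors_list (map (\<lambda>i. Factor (h i)) xs))"
  by (induction xs rule: rev_induct) (auto simp: set_factors_list inj_eq)

lemma set_XS [simp]: "finite R \<Longrightarrow> set_factors (XS R) = X_label ` R"
  and set_YS [simp]: "finite R \<Longrightarrow> set_factors (YS R) = Y_label ` R"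
  and distinct_XS [simp]: "distinct_factors (XS R)"
  and distinct_YS [simp]: "distinct_factors (YS R)"
  by (auto simp: XS_def YS_def set_factors_list inj_def intro: distinct_factors_list_map_Factor)

lemma ex_factors: "finite A \<Longrightarrow> \<exists>u. set_factors u = A"
proof -
  assume "finite A"
  then obtain xs where "set xs = A" using finite_list by blast
  then have "set_factors (factors_list (map Factor xs)) = A" by (auto simp: set_factors_list)
  then show ?thesis by blast
qed

lemma finite_set_factors [simp]: "finite (set_factors u)"
  by (induction u) auto

lemma initial_eq:
  "initial (int n) = {..n}" "initial (int t - 1) = {..<t}" "initial (int t - 2) = {..<t - 1}"
  by (auto simp: initial_def)

lemma all_factors_0: "all_factors 0 = Tens Unit (Tens (Factor (X_label 0)) (Factor (Y_label 0)))"
  using factors_list_snoc [of "[]"] by (simp add: all_factors_def)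

lemma all_factors_Suc:
  "all_factors (Suc n) = Tens (all_factors n) (Tens (Factor (X_label (Suc n))) (Factor (Y_label (Suc n))))"
  by (simp add: all_factors_def factors_list_def)

lemma set_all_factors: "set_factors (all_factors n) = labels_before (Suc n)"
  by (induction n) (auto simp: all_factors_0 all_factors_Suc labels_before_Suc)

lemma distinct_all_factors: "distinct_factors (all_factors n)"
  by (induction n) (auto simp: all_factors_0 all_factors_Suc set_all_factors)

context markov_category
begin

lemma tuple_generated_mono:
  assumes "generated p (tuple F w u) (tuple F w k) (tuple F w z)" "Cod C p = obj C F w"
    "set_factors u \<subseteq> set_factors w" "set_factors k \<subseteq> set_factors w" "set_factors z' \<subseteq> set_factors w"
    "set_factors u' \<subseteq> set_factors u" "set_factors k' \<subseteq> set_factors k" "set_factors z \<subseteq> set_factors z'"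
  shows "generated p (tuple F w u') (tuple F w k') (tuple F w z')"
proof -
  have "generated p (tuple F u u' \<cdot> tuple F w u) (tuple F k k' \<cdot> tuple F w k) (tuple F w z')"
    by (rule generated_mono [OF assms(1), where g = "tuple F z' z"])
      (use assms in \<open>simp_all add: tuple_comp\<close>)
  then show ?thesis using assms by (simp add: tuple_comp)
qed

text \<open>Bracketing, order and repetition of labels are quantified away; by
  \<open>set_indep_iff_generated\<close> every choice gives the same relation. The sets may
  overlap.\<close>

definition set_indep :: "('l \<Rightarrow> 'a) \<Rightarrow> 'l factors \<Rightarrow> 'b \<Rightarrow> 'l set \<Rightarrow> 'l set \<Rightarrow> 'l set \<Rightarrow> bool" where
  "set_indep F w p A B S \<longleftrightarrow> A \<union> B \<union> S \<subseteq> set_factors w \<and>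
     (\<exists>u k z. set_factors u = A \<and> set_factors k = B \<union> S \<and> set_factors z = S \<and>
       generated p (tuple F w u) (tuple F w k) (tuple F w z))"

lemma set_indep_iff_generated:
  assumes "Cod C p = obj C F w" "set_factors u = A" "set_factors k = B \<union> S" "set_factors z = S"
    "A \<union> B \<union> S \<subseteq> set_factors w"
  shows "set_indep F w p A B S \<longleftrightarrow> generated p (tuple F w u) (tuple F w k) (tuple F w z)"
proof
  assume "set_indep F w p A B S"
  then obtain u' k' z' where "set_factors u' = A" "set_factors k' = B \<union> S" "set_factors z' = S"
    "generated p (tuple F w u') (tuple F w k') (tuple F w z')"
    by (auto simp: set_indep_def)
  then show "generated p (tuple F w u) (tuple F w k) (tuple F w z)"
    using assms by (intro tuple_generated_mono [of p F w u' k' z' z u k]) auto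
next
  assume "generated p (tuple F w u) (tuple F w k) (tuple F w z)"
  then show "set_indep F w p A B S" using assms by (auto simp: set_indep_def)
qed

lemma set_indep_obtain:
  assumes "set_indep F w p A B S"
  obtains u v z where "set_factors u = A" "set_factors v = B" "set_factors z = S"
    "A \<subseteq> set_factors w" "B \<subseteq> set_factors w" "S \<subseteq> set_factors w"
proof -
  have AB: "A \<subseteq> set_factors w" "B \<subseteq> set_factors w" "S \<subseteq> set_factors w"
    using assms by (auto simp: set_indep_def)
  then show thesis
    using that ex_factors [of A] ex_factors [of B] ex_factors [of S]
    by (metis finite_set_factors finite_subset)
qed

lemma set_indep_mono:
  assumes "set_indep F w p A B S" "Cod C p = obj C F w"
    "A' \<subseteq> A" "B' \<subseteq> B \<union> S" "S \<subseteq> S'" "S' \<subseteq> B \<union> S"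
  shows "set_indep F w p A' B' S'"
proof -
  obtain u v z where uvz: "set_factors u = A" "set_factors v = B" "set_factors z = S"
    "A \<subseteq> set_factors w" "B \<subseteq> set_factors w" "S \<subseteq> set_factors w"
    using set_indep_obtain [OF assms(1)] by metis
  have AB: "A' \<subseteq> set_factors w" "B' \<subseteq> set_factors w" "S' \<subseteq> set_factors w"
    using uvz assms by auto
  obtain u' v' z' where uvz': "set_factors u' = A'" "set_factors v' = B'" "set_factors z' = S'"
    using AB ex_factors by (metis finite_set_factors finite_subset)
  have "generated p (tuple F w u) (tuple F w (Tens v z)) (tuple F w z)"
    using set_indep_iff_generated [of p F w u A "Tens v z" B S z] uvz assms by simp
  then have "generated p (tuple F w u') (tuple F w (Tens v' z')) (tuple F w z')"
    by (rule tuple_generated_mono) (use uvz uvz' AB assms in auto)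
  then show ?thesis
    using set_indep_iff_generated [of p F w u' A' "Tens v' z'" B' S' z'] uvz' AB assms by simp
qed

end

context markov_category_with_conditionals
begin

lemma set_indep_iff_cond_indep:
  assumes "Dom C p = \<I>" "Cod C p = obj C F w"
    "set_factors u \<union> set_factors v \<union> set_factors z \<subseteq> set_factors w"
  shows "set_indep F w p (set_factors u) (set_factors v) (set_factors z) \<longleftrightarrow>
    cond_indep p (tuple F w u) (tuple F w v) (tuple F w z)"
  using assms set_indep_iff_generated [of p F w u "set_factors u" "Tens v z" "set_factors v" "set_factors z" z]
  by (simp add: cond_indep_iff_generated)

text \<open>Symmetry is checked on \<open>cond_indep\<close>, the other axioms on
  \<open>generated\<close>, where contraction is \<open>generated_trans\<close> with the
  intermediate condition \<open>S \<union> D\<close>.\<close>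

lemma separoid_set_indep:
  fixes F :: "'l \<Rightarrow> 'a"
  assumes p: "Dom C p = \<I>" "Cod C p = obj C F w"
  shows "separoid (set_factors w) (set_indep F w p)"
proof
  fix A B S A' B' S' D :: "'l set"
  show "set_indep F w p B A S" if "set_indep F w p A B S"
  proof -
    obtain u v z where uvz: "set_factors u = A" "set_factors v = B" "set_factors z = S"
      "A \<subseteq> set_factors w" "B \<subseteq> set_factors w" "S \<subseteq> set_factors w"
      using set_indep_obtain [OF \<open>set_indep F w p A B S\<close>] by metis
    have "cond_indep p (tuple F w u) (tuple F w v) (tuple F w z)"
      using set_indep_iff_cond_indep [of p F w u v z] p uvz that by simp
    then have "cond_indep p (tuple F w v) (tuple F w u) (tuple F w z)"
      by (rule cond_indep_sym) (use p uvz in simp_all)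
    then show ?thesis
      using set_indep_iff_cond_indep [of p F w v u z] p uvz by simp
  qed
  show "set_indep F w p A B S" if "A \<subseteq> S" "B \<union> S \<subseteq> set_factors w"
  proof -
    have AB: "A \<subseteq> set_factors w" "B \<subseteq> set_factors w" "S \<subseteq> set_factors w"
      using that by auto
    obtain u v z where uvz: "set_factors u = A" "set_factors v = B" "set_factors z = S"
      using AB ex_factors by (metis finite_set_factors finite_subset)
    \<comment> \<open>Since \<open>A \<subseteq> S\<close>, the variable \<open>u\<close> is a
      function of \<open>z\<close>; that function is the kernel.\<close>
    have "generated p (tuple F w u) (tuple F w (Tens v z)) (tuple F w z)"
      by (rule generatedI [of "tuple F z u"]) (use uvz AB that in \<open>simp_all add: tuple_comp\<close>)
    then show ?thesis
      using set_indep_iff_generated [of p F w u A "Tens v z" B S z] uvz AB p by simp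
  qed
  show "set_indep F w p A' B' S'"
    if "set_indep F w p A B S" "A' \<subseteq> A" "B' \<subseteq> B \<union> S" "S \<subseteq> S'" "S' \<subseteq> B \<union> S"
    using set_indep_mono [OF that(1) p(2) that(2-)] .
  show "set_indep F w p A (B \<union> D) S" if 1: "set_indep F w p A B (S \<union> D)" and 2: "set_indep F w p A D S"
  proof -
    obtain u v s where uvs: "set_factors u = A" "set_factors v = B" "set_factors s = S \<union> D"
      "A \<subseteq> set_factors w" "B \<subseteq> set_factors w" "S \<union> D \<subseteq> set_factors w"
      using set_indep_obtain [OF 1] by metis
    obtain z where z: "set_factors z = S"
      using set_indep_obtain [OF 2] by metis
    have g1: "generated p (tuple F w u) (tuple F w (Tens v s)) (tuple F w s)"
      using set_indep_iff_generated [of p F w u A "Tens v s" B "S \<union> D" s] uvs p 1 by simp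
    have g2: "generated p (tuple F w u) (tuple F w s) (tuple F w z)"
      using set_indep_iff_generated [of p F w u A s D S z] uvs z p 2 by (simp add: Un_commute)
    have e1: "tuple F w z = tuple F s z \<cdot> tuple F w s"
      by (rule tuple_comp [symmetric]) (use uvs z in auto)
    have e2: "tuple F w s = tuple F (Tens v s) s \<cdot> tuple F w (Tens v s)"
      by (rule tuple_comp [symmetric]) (use uvs in auto)
    have "generated p (tuple F w u) (tuple F w (Tens v s)) (tuple F w z)"
      by (rule generated_trans [OF g1 g2 e1 _ e2]) (use uvs z p in auto)
    then show ?thesis
      using set_indep_iff_generated [of p F w u A "Tens v s" "B \<union> D" S z] uvs z p by (simp add: Un_ac)
  qed
qed

lemma displays_iff_set_indep:
  assumes "distinct_factors w" "Dom C p = \<I>" "Cod C p = obj C F w"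
    "distinct_factors (Tens u (Tens v z))" "set_factors (Tens u (Tens v z)) \<subseteq> set_factors w"
  shows "displays C F w p u v z \<longleftrightarrow> set_indep F w p (set_factors u) (set_factors v) (set_factors z)"
  using displays_iff_cond_indep [OF assms(1,3-5)] set_indep_iff_cond_indep [of p F w u v z] assms
  by simp

end

section \<open>The Markov properties as independences of label sets\<close>

locale hidden_markov_state = markov_category_with_conditionals +
  fixes X Y :: "nat \<Rightarrow> 'a" and n :: nat and p :: 'b
  assumes Dom_p: "Dom C p = \<I>" and Cod_p: "Cod C p = obj C (case_label X Y) (all_factors n)"
begin

abbreviation F :: "label \<Rightarrow> 'a" where "F \<equiv> case_label X Y"

abbreviation ind :: "label set \<Rightarrow> label set \<Rightarrow> label set \<Rightarrow> bool" where
  "ind \<equiv> set_indep F (all_factors n) p"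

sublocale separoid "labels_before (Suc n)" ind
  using separoid_set_indep [OF Dom_p Cod_p] by (simp add: set_all_factors)

lemma indep_iff:
  assumes "distinct_factors (Tens u (Tens v z))" "set_factors (Tens u (Tens v z)) \<subseteq> labels_before (Suc n)"
  shows "indep C X Y n p u v z \<longleftrightarrow> ind (set_factors u) (set_factors v) (set_factors z)"
  unfolding indep_def
  by (rule displays_iff_set_indep) (use assms Dom_p Cod_p distinct_all_factors set_all_factors in auto)

lemma indep_X_iff:
  assumes "t \<in> {1..n}"
  shows "indep C X Y n p (Factor (X_label t)) (Tens (XS (initial (int t - 2))) (YS (initial (int t - 1))))
      (Factor (X_label (t - 1))) \<longleftrightarrow>
    ind {X_label t} (X_label ` {..<t - 1} \<union> Y_label ` {..<t}) {X_label (t - 1)}"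
  using assms by (subst indep_iff) (auto simp: initial_eq)

lemma backward_markov_iff:
  "backward_markov C X Y n p \<longleftrightarrow>
    (\<forall>t \<in> {1..n}. ind {X_label t} (X_label ` {..<t - 1} \<union> Y_label ` {..<t}) {X_label (t - 1)}) \<and>
    (\<forall>t \<in> {1..n}. ind {Y_label t} (Y_label ` {..<t} \<union> X_label ` {..<t}) {X_label t})"
proof -
  have "indep C X Y n p (Factor (Y_label t)) (Tens (YS (initial (int t - 1))) (XS (initial (int t - 1))))
      (Factor (X_label t)) \<longleftrightarrow> ind {Y_label t} (Y_label ` {..<t} \<union> X_label ` {..<t}) {X_label t}"
    if "t \<in> {1..n}" for t
    using that by (subst indep_iff) (auto simp: initial_eq)
  then show ?thesis
    unfolding backward_markov_def
    by (intro arg_cong2 [where f = "(\<and>)"] ball_cong refl indep_X_iff)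
qed

lemma local_markov_iff:
  "local_markov C X Y n p \<longleftrightarrow>
    (\<forall>t \<in> {1..n}. ind {X_label t} (X_label ` {..<t - 1} \<union> Y_label ` {..<t}) {X_label (t - 1)}) \<and>
    (\<forall>t \<in> {0..n}. ind {Y_label t} (X_label ` ({..n} - {t}) \<union> Y_label ` ({..n} - {t})) {X_label t})"
proof -
  have "indep C X Y n p (Factor (Y_label t)) (Tens (XS (initial (int n) - {t})) (YS (initial (int n) - {t})))
      (Factor (X_label t)) \<longleftrightarrow>
      ind {Y_label t} (X_label ` ({..n} - {t}) \<union> Y_label ` ({..n} - {t})) {X_label t}"
    if "t \<in> {0..n}" for t
    using that by (subst indep_iff) (auto simp: initial_eq)
  then show ?thesis
    unfolding local_markov_def
    by (intro arg_cong2 [where f = "(\<and>)"] ball_cong refl indep_X_iff)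
qed

lemma local_imp_backward: "local_markov C X Y n p \<Longrightarrow> backward_markov C X Y n p"
  unfolding local_markov_iff backward_markov_iff
  by (auto elim!: ind_mono)

lemma backward_imp_separation:
  assumes "backward_markov C X Y n p"
    "A \<subseteq> labels_before (Suc n)" "B \<subseteq> labels_before (Suc n)" "S \<subseteq> labels_before (Suc n)"
    "\<And>a b. \<lbrakk>a \<in> A; b \<in> B\<rbrakk> \<Longrightarrow> separates S a b"
  shows "ind A B S"
proof (rule hidden_markov_separation [OF separoid_axioms])
  fix t
  assume t: "Suc t \<le> n"
  then have "ind {X_label (Suc t)} (X_label ` {..<t} \<union> Y_label ` {..<Suc t}) {X_label t}"
    using assms(1) unfolding backward_markov_iff by (force dest: bspec [of _ _ "Suc t"])
  then show "ind {X_label (Suc t)} (labels_before (Suc t)) {X_label t}"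
    by (rule ind_mono) (auto simp: labels_before_def)
next
  fix t
  assume t: "t \<le> n"
  show "ind {Y_label t} (labels_before t) {X_label t}"
  proof (cases t)
    case 0
    \<comment> \<open>The backward property is silent at time 0, but nothing precedes
      \<open>Y 0\<close> and \<open>X 0\<close>, so the second set is empty.\<close>
    show ?thesis
      unfolding 0 by (rule ind_sym, rule ind_trivial) auto
  next
    case (Suc s)
    then show ?thesis
      using assms(1) t unfolding backward_markov_iff labels_before_def
      by (simp add: Un_commute)
  qed
qed (use assms in auto)

lemma backward_imp_global:
  assumes "backward_markov C X Y n p"
  shows "global_markov C X Y n p"
  unfolding global_markov_def
proof (intro allI impI, elim conjE)
  fix R S T U V W :: "nat set"
  assume sub: "R \<subseteq> initial (int n)" "S \<subseteq> initial (int n)" "T \<subseteq> initial (int n)"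
      "U \<subseteq> initial (int n)" "V \<subseteq> initial (int n)" "W \<subseteq> initial (int n)"
    and disj: "R \<inter> S = {}" "R \<inter> T = {}" "S \<inter> T = {}" "U \<inter> V = {}" "U \<inter> W = {}" "V \<inter> W = {}"
    and sep: "\<forall>r \<in> R. \<forall>t \<in> T. \<exists>s \<in> S. r < s \<and> s < t \<or> r > s \<and> s > t"
      "\<forall>u \<in> U. \<forall>w \<in> W. \<exists>s \<in> S. u \<le> s \<and> s \<le> w \<or> u \<ge> s \<and> s \<ge> w"
      "\<forall>r \<in> R. \<forall>w \<in> W. \<exists>s \<in> S. r < s \<and> s \<le> w \<or> r > s \<and> s \<ge> w"
      "\<forall>u \<in> U. \<forall>t \<in> T. \<exists>s \<in> S. u \<le> s \<and> s < t \<or> u \<ge> s \<and> s > t"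
  have fin: "finite R" "finite S" "finite T" "finite U" "finite V" "finite W"
    using sub finite_subset [of _ "{..n}"] by (simp_all add: initial_eq)
  have "ind (X_label ` R \<union> Y_label ` U) (X_label ` T \<union> Y_label ` W) (X_label ` S \<union> Y_label ` V)"
  proof (rule backward_imp_separation [OF assms])
    fix a b
    assume "a \<in> X_label ` R \<union> Y_label ` U" "b \<in> X_label ` T \<union> Y_label ` W"
    then consider r t where "a = X_label r" "b = X_label t" "r \<in> R" "t \<in> T"
      | r t where "a = X_label r" "b = Y_label t" "r \<in> R" "t \<in> W"
      | r t where "a = Y_label r" "b = X_label t" "r \<in> U" "t \<in> T"
      | r t where "a = Y_label r" "b = Y_label t" "r \<in> U" "t \<in> W"
      by blast
    then have "a \<noteq> b \<and> (\<exists>s \<in> S. time a \<le> s \<and> s \<le> time b \<or> time b \<le> s \<and> s \<le> time a)"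
    proof cases
      case (1 r t)
      then obtain s where "s \<in> S" "r < s \<and> s < t \<or> r > s \<and> s > t" using sep(1) by blast
      then show ?thesis using 1 by (auto intro!: bexI [of _ s])
    next
      case (2 r t)
      then obtain s where "s \<in> S" "r < s \<and> s \<le> t \<or> r > s \<and> s \<ge> t" using sep(3) by blast
      then show ?thesis using 2 by (auto intro!: bexI [of _ s])
    next
      case (3 r t)
      then obtain s where "s \<in> S" "r \<le> s \<and> s < t \<or> r \<ge> s \<and> s > t" using sep(4) by blast
      then show ?thesis using 3 by (auto intro!: bexI [of _ s])
    next
      case (4 r t)
      then obtain s where "s \<in> S" "r \<le> s \<and> s \<le> t \<or> r \<ge> s \<and> s \<ge> t" using sep(2) by blast
      \<comment> \<open>Disjointness of \<open>U\<close> and \<open>W\<close> rules out one observed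
        vertex on both sides, which no hidden vertex could separate from itself.\<close>
      moreover have "r \<noteq> t" using 4 disj by blast
      ultimately show ?thesis using 4 by (auto intro!: bexI [of _ s])
    qed
    then show "separates (X_label ` S \<union> Y_label ` V) a b"
      by (auto simp: separates_def)
  qed (use sub in \<open>auto simp: initial_eq labels_before_def\<close>)
  then show "indep C X Y n p (Tens (XS R) (YS U)) (Tens (XS T) (YS W)) (Tens (XS S) (YS V))"
    using sub disj fin by (subst indep_iff) (auto simp: initial_eq labels_before_def)
qed

lemma global_imp_local:
  assumes "global_markov C X Y n p"
  shows "local_markov C X Y n p"
proof -
  have glob: "ind (X_label ` R \<union> Y_label ` U) (X_label ` T \<union> Y_label ` W) (X_label ` S)"
    if sub: "R \<subseteq> {..n}" "S \<subseteq> {..n}" "T \<subseteq> {..n}" "U \<subseteq> {..n}" "W \<subseteq> {..n}"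
      and disj: "R \<inter> S = {}" "R \<inter> T = {}" "S \<inter> T = {}" "U \<inter> W = {}"
      and sep: "\<forall>r \<in> R. \<forall>t \<in> T. \<exists>s \<in> S. r < s \<and> s < t \<or> r > s \<and> s > t"
        "\<forall>u \<in> U. \<forall>w \<in> W. \<exists>s \<in> S. u \<le> s \<and> s \<le> w \<or> u \<ge> s \<and> s \<ge> w"
        "\<forall>r \<in> R. \<forall>w \<in> W. \<exists>s \<in> S. r < s \<and> s \<le> w \<or> r > s \<and> s \<ge> w"
        "\<forall>u \<in> U. \<forall>t \<in> T. \<exists>s \<in> S. u \<le> s \<and> s < t \<or> u \<ge> s \<and> s > t"
    for R S T U W :: "nat set"
  proof -
    have fin: "finite R" "finite S" "finite T" "finite U" "finite W"
      using sub finite_subset [of _ "{..n}"] by simp_all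
    have "indep C X Y n p (Tens (XS R) (YS U)) (Tens (XS T) (YS W)) (Tens (XS S) (YS {}))"
      using assms [unfolded global_markov_def, rule_format, of R S T U "{}" W] that
      by (simp add: initial_eq)
    then show ?thesis
      using sub disj fin by (subst (asm) indep_iff) (auto simp: labels_before_def)
  qed
  show ?thesis
    unfolding local_markov_iff
  proof (intro conjI ballI)
    fix t
    assume t: "t \<in> {1..n}"
    \<comment> \<open>The single separating index is \<open>t - 1\<close>. Earlier hidden variables
      lie strictly before it, whereas \<open>Y (t - 1)\<close> is reached only through
      \<open>X (t - 1)\<close>, which the weak inequality for observed variables admits.\<close>
    then have "{..<t - 1} \<subseteq> {..n}" "{..<t} \<subseteq> {..n}" "\<forall>w \<in> {..<t}. w \<le> t - 1" by auto
    with t show "ind {X_label t} (X_label ` {..<t - 1} \<union> Y_label ` {..<t}) {X_label (t - 1)}"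
      using glob [of "{t}" "{t - 1}" "{..<t - 1}" "{}" "{..<t}"] by auto
  next
    fix t
    assume "t \<in> {0..n}"
    moreover have "\<forall>w \<in> {..n} - {t}. t < w \<or> w < t" "\<forall>w \<in> {..n} - {t}. t \<le> w \<or> w \<le> t" by auto
    ultimately show "ind {Y_label t} (X_label ` ({..n} - {t}) \<union> Y_label ` ({..n} - {t})) {X_label t}"
      using glob [of "{}" "{t}" "{..n} - {t}" "{t}" "{..n} - {t}"] by auto
  qed
qed

end

section \<open>Hidden Markov form\<close>

definition X_factors :: "nat \<Rightarrow> label factors" where
  "X_factors k = factors_list (map (\<lambda>t. Factor (X_label t)) [0..<k])"

text \<open>\<open>all_factors\<close> with its bound shifted by one, so that inductions start from
  the empty product.\<close>

definition XY_factors :: "nat \<Rightarrow> label factors" where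
  "XY_factors k = factors_list (map (\<lambda>t. Tens (Factor (X_label t)) (Factor (Y_label t))) [0..<k])"

lemma X_factors_simps [simp]:
  "X_factors 0 = Unit" "X_factors (Suc k) = Tens (X_factors k) (Factor (X_label k))"
  by (simp_all add: X_factors_def)

lemma XY_factors_simps [simp]:
  "XY_factors 0 = Unit"
  "XY_factors (Suc k) = Tens (XY_factors k) (Tens (Factor (X_label k)) (Factor (Y_label k)))"
  by (simp_all add: XY_factors_def)

lemma all_factors_eq: "all_factors n = XY_factors (Suc n)"
  by (simp only: all_factors_def XY_factors_def)

lemma set_X_factors [simp]: "set_factors (X_factors k) = X_label ` {..<k}"
  by (induction k) (auto simp: lessThan_Suc)

lemma set_XY_factors [simp]: "set_factors (XY_factors k) = labels_before k"
  by (induction k) (auto simp: labels_before_Suc)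

lemma distinct_XY_factors [simp]: "distinct_factors (XY_factors k)"
  by (induction k) auto

lemma obj_list_snoc [simp]: "obj_list C (As @ [A]) = obj_list C As \<otimes>\<^bsub>C\<^esub> A"
  and obj_list_Nil [simp]: "obj_list C [] = \<I>\<^bsub>C\<^esub>"
  and map_list_snoc [simp]: "map_list C (fs @ [h]) = map_list C fs \<boxtimes>\<^bsub>C\<^esub> h"
  and map_list_Nil [simp]: "map_list C [] = Id C \<I>\<^bsub>C\<^esub>"
  by (simp_all add: obj_list_def map_list_def)

lemma obj_X_factors: "obj C (case_label X Y) (X_factors k) = obj_list C (map X [0..<k])"
  by (induction k) auto

lemma obj_XY_factors:
  "obj C (case_label X Y) (XY_factors k) = obj_list C (map (\<lambda>t. X t \<otimes>\<^bsub>C\<^esub> Y t) [0..<k])"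
  by (induction k) auto

context hidden_markov_state
begin

text \<open>A variable on the sample space rather than a distribution; the actual joint law of the
  factors in \<open>u\<close> is \<open>law u \<cdot> p\<close>.\<close>

abbreviation law :: "label factors \<Rightarrow> 'b" where
  "law u \<equiv> tuple F (all_factors n) u"

abbreviation xv :: "nat \<Rightarrow> 'b" where "xv t \<equiv> label_pr F (all_factors n) (X_label t)"
abbreviation yv :: "nat \<Rightarrow> 'b" where "yv t \<equiv> label_pr F (all_factors n) (Y_label t)"

lemma label_pr_all [simp]:
  assumes "t \<le> n"
  shows "Dom C (xv t) = Cod C p" "Cod C (xv t) = X t" "det (xv t)"
    "Dom C (yv t) = Cod C p" "Cod C (yv t) = Y t" "det (yv t)"
  using assms by (simp_all add: Cod_p set_all_factors)

lemma law [simp]: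
  assumes "set_factors u \<subseteq> labels_before (Suc n)"
  shows "Dom C (law u) = Cod C p" "Cod C (law u) = obj C F u" "det (law u)"
  using assms by (simp_all add: Cod_p set_all_factors)

lemma ind_iff_generated:
  assumes "set_factors u = A" "set_factors k = B \<union> S" "set_factors z = S" "A \<union> B \<union> S \<subseteq> labels_before (Suc n)"
  shows "ind A B S \<longleftrightarrow> generated p (law u) (law k) (law z)"
  by (rule set_indep_iff_generated) (use assms Cod_p set_all_factors in simp_all)

section \<open>From the local Markov property to the hidden Markov form\<close>

definition emissions :: "(nat \<Rightarrow> 'b) \<Rightarrow> nat \<Rightarrow> 'b" where
  "emissions g k = map_list C (map (\<lambda>t. (Id C (X t) \<boxtimes> g t) \<cdot> copy C (X t)) [0..<k])"

lemma emissions_0: "emissions g 0 = Id C \<I>"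
  by (simp add: emissions_def)

lemma emissions_Suc:
  "Dom C (g k) = X k \<Longrightarrow> emissions g (Suc k) = emissions g k \<boxtimes> \<langle>Id C (X k), g k\<rangle>"
  by (simp add: emissions_def pair_def)

lemma Dom_Cod_emissions:
  assumes "\<And>t. t < k \<Longrightarrow> Dom C (g t) = X t \<and> Cod C (g t) = Y t"
  shows "Dom C (emissions g k) = obj C F (X_factors k)" "Cod C (emissions g k) = obj C F (XY_factors k)"
proof -
  have "Dom C (emissions g k) = obj C F (X_factors k) \<and> Cod C (emissions g k) = obj C F (XY_factors k)"
    using assms by (induction k) (simp_all add: emissions_0 emissions_Suc)
  then show "Dom C (emissions g k) = obj C F (X_factors k)" "Cod C (emissions g k) = obj C F (XY_factors k)"
    by auto
qed

lemma chain_Suc_pair: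
  assumes "Dom C (f (Suc t)) = X t"
  shows "chain C X f (Suc t) = assoc' C (obj C F (X_factors t)) (X t) (X (Suc t))
    \<cdot> (Id C (obj C F (X_factors t)) \<boxtimes> \<langle>Id C (X t), f (Suc t)\<rangle>) \<cdot> chain C X f t"
  using assms by (simp add: obj_X_factors pair_def)

lemma hidden_markov_form_iff:
  "hidden_markov_form C X Y n p \<longleftrightarrow>
    (\<exists>f g. Dom C (f 0) = \<I> \<and> Cod C (f 0) = X 0 \<and>
      (\<forall>t < n. Dom C (f (Suc t)) = X t \<and> Cod C (f (Suc t)) = X (Suc t)) \<and>
      (\<forall>t \<le> n. Dom C (g t) = X t \<and> Cod C (g t) = Y t) \<and>
      p = emissions g (Suc n) \<cdot> chain C X f n)"
proof -
  have "{1..n} = Suc ` {..<n}" by (auto simp: image_Suc_lessThan)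
  then have 1: "(\<forall>t \<in> {1..n}. P t) \<longleftrightarrow> (\<forall>t < n. P (Suc t))" for P
    by auto
  have 2: "(\<forall>t \<in> {0..n}. P t) \<longleftrightarrow> (\<forall>t \<le> n. P t)" for P
    by auto
  show ?thesis
    unfolding hidden_markov_form_def emissions_def 1 2 by (simp add: hom_iff conj_ac del: upt_Suc)
qed

text \<open>The spectators in the hypothesis on \<open>f (Suc t)\<close> are exactly
  \<open>X 0, ..., X t\<close>, so replacing the next hidden variable by the output of the kernel
  leaves the joint law of the whole chain unchanged.\<close>

lemma chain_eq_law:
  assumes f0: "f 0 = xv 0 \<cdot> p"
    and f: "\<And>t. t < n \<Longrightarrow> Dom C (f (Suc t)) = X t \<and> Cod C (f (Suc t)) = X (Suc t) \<and>
      \<langle>xv (Suc t), law (X_factors (Suc t))\<rangle> \<cdot> p = \<langle>f (Suc t) \<cdot> xv t, law (X_factors (Suc t))\<rangle> \<cdot> p"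
    and "t \<le> n"
  shows "chain C X f t = law (X_factors (Suc t)) \<cdot> p"
  using \<open>t \<le> n\<close>
proof (induction t)
  case 0
  have "lunit' C (X 0) \<cdot> xv 0 \<cdot> p = (lunit' C (X 0) \<cdot> xv 0) \<cdot> p"
    by simp
  also have "\<dots> = \<langle>del C (Cod C p), xv 0\<rangle> \<cdot> p"
    by (subst lunit'_comp) simp_all
  finally show ?case by (simp add: f0 Cod_p)
next
  case (Suc t)
  let ?k = "law (X_factors t)" and ?O = "obj C F (X_factors t)"
  have t: "t < n" using Suc by simp
  have sub: "X_label ` {..<t} \<subseteq> labels_before (Suc n)" using t by (auto simp: labels_before_def)
  have *: "\<langle>xv (Suc t), \<langle>?k, xv t\<rangle>\<rangle> \<cdot> p = \<langle>f (Suc t) \<cdot> xv t, \<langle>?k, xv t\<rangle>\<rangle> \<cdot> p"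
    using f [OF t] by simp
  have ft: "Dom C (f (Suc t)) = X t" "Cod C (f (Suc t)) = X (Suc t)"
    using f [OF t] by auto
  have "chain C X f (Suc t) = assoc' C ?O (X t) (X (Suc t))
    \<cdot> (Id C ?O \<boxtimes> \<langle>Id C (X t), f (Suc t)\<rangle>) \<cdot> \<langle>?k, xv t\<rangle> \<cdot> p"
    using ft Suc t by (subst chain_Suc_pair) simp_all
  also have "\<dots> = \<langle>\<langle>?k, xv t\<rangle>, f (Suc t) \<cdot> xv t\<rangle> \<cdot> p"
    using ft t sub by (simp add: pair_simps pair_det_simps)
  also have "\<dots> = swap C (X (Suc t)) (?O \<otimes> X t) \<cdot> \<langle>f (Suc t) \<cdot> xv t, \<langle>?k, xv t\<rangle>\<rangle> \<cdot> p"
    using ft t sub by (simp add: pair_simps)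
  also have "\<dots> = swap C (X (Suc t)) (?O \<otimes> X t) \<cdot> \<langle>xv (Suc t), \<langle>?k, xv t\<rangle>\<rangle> \<cdot> p"
    by (simp only: *)
  also have "\<dots> = law (X_factors (Suc (Suc t))) \<cdot> p"
    using ft t sub by (simp add: pair_simps)
  finally show ?case .
qed

text \<open>The spectator \<open>z\<close> keeps the hidden variables that the later emissions still need.\<close>

lemma emissions_law:
  assumes g: "\<And>t. t \<le> n \<Longrightarrow> Dom C (g t) = X t \<and> Cod C (g t) = Y t"
    and gy: "\<And>t k. t \<le> n \<Longrightarrow> set_factors k \<subseteq> labels_before (Suc n) - {Y_label t} \<Longrightarrow>
      \<langle>yv t, law k\<rangle> \<cdot> p = \<langle>g t \<cdot> xv t, law k\<rangle> \<cdot> p"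
    and "k \<le> Suc n" "set_factors z \<subseteq> X_label ` {..n}"
  shows "\<langle>emissions g k \<cdot> law (X_factors k), law z\<rangle> \<cdot> p = \<langle>law (XY_factors k), law z\<rangle> \<cdot> p"
  using assms(3,4)
proof (induction k arbitrary: z)
  case 0
  then have "set_factors z \<subseteq> labels_before (Suc n)" by (auto simp: labels_before_def)
  then show ?case by (simp add: emissions_0)
next
  case (Suc k)
  let ?M = "emissions g k" and ?K = "law (X_factors k)" and ?J = "law (XY_factors k)"
  let ?O = "obj C F (X_factors k)" and ?P = "obj C F (XY_factors k)" and ?Z = "obj C F z"
  have k: "k \<le> n" using Suc by simp
  have M: "Dom C ?M = ?O" "Cod C ?M = ?P" using Dom_Cod_emissions [of k g] g k by auto
  have sub: "X_label ` {..<k} \<subseteq> labels_before (Suc n)" "labels_before k \<subseteq> labels_before (Suc n)"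
    "set_factors z \<subseteq> labels_before (Suc n)"
    using k Suc.prems by (auto simp: labels_before_def)
  note gk = g [OF k, THEN conjunct1] g [OF k, THEN conjunct2]
  note ty = M sub k gk
  \<comment> \<open>\<open>X k\<close> joins the spectators: it must survive the first
    \<open>k\<close> emissions in order to feed \<open>g k\<close>.\<close>
  have IH: "\<langle>?M \<cdot> ?K, \<langle>xv k, law z\<rangle>\<rangle> \<cdot> p = \<langle>?J, \<langle>xv k, law z\<rangle>\<rangle> \<cdot> p"
    using Suc.IH [of "Tens (Factor (X_label k)) z"] Suc.prems by simp
  have gen: "\<langle>yv k, \<langle>?J, \<langle>xv k, law z\<rangle>\<rangle>\<rangle> \<cdot> p = \<langle>g k \<cdot> xv k, \<langle>?J, \<langle>xv k, law z\<rangle>\<rangle>\<rangle> \<cdot> p"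
  proof -
    have "set_factors (Tens (XY_factors k) (Tens (Factor (X_label k)) z)) \<subseteq> labels_before (Suc n) - {Y_label k}"
      using Suc.prems k by (auto simp: labels_before_def)
    from gy [OF k this] show ?thesis by simp
  qed
  \<comment> \<open>\<open>?r\<close> samples \<open>g k\<close> from \<open>X k\<close>, keeping
    \<open>X k\<close>; \<open>?s\<close> merely moves a value of type \<open>Y k\<close> from the
    front to its place behind \<open>X k\<close>.\<close>
  let ?r = "assoc' C ?P (X k \<otimes> Y k) ?Z \<cdot> (Id C ?P \<boxtimes> (\<langle>Id C (X k), g k\<rangle> \<boxtimes> Id C ?Z))"
  let ?s = "assoc' C ?P (X k \<otimes> Y k) ?Z \<cdot> (Id C ?P \<boxtimes> (assoc' C (X k) (Y k) ?Z
    \<cdot> (Id C (X k) \<boxtimes> swap C ?Z (Y k)) \<cdot> assoc C (X k) ?Z (Y k)))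
    \<cdot> assoc C ?P (X k \<otimes> ?Z) (Y k) \<cdot> swap C (Y k) (?P \<otimes> X k \<otimes> ?Z)"
  have "\<langle>emissions g (Suc k) \<cdot> law (X_factors (Suc k)), law z\<rangle> \<cdot> p
      = \<langle>\<langle>?M \<cdot> ?K, \<langle>xv k, g k \<cdot> xv k\<rangle>\<rangle>, law z\<rangle> \<cdot> p"
    using ty by (simp add: emissions_Suc pair_simps pair_det_simps)
  also have "\<dots> = ?r \<cdot> \<langle>?M \<cdot> ?K, \<langle>xv k, law z\<rangle>\<rangle> \<cdot> p"
    using ty by (simp add: pair_simps pair_det_simps)
  also have "\<dots> = ?r \<cdot> \<langle>?J, \<langle>xv k, law z\<rangle>\<rangle> \<cdot> p"
    by (simp only: IH)
  also have "\<dots> = ?s \<cdot> \<langle>g k \<cdot> xv k, \<langle>?J, \<langle>xv k, law z\<rangle>\<rangle>\<rangle> \<cdot> p"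
    using ty by (simp add: pair_simps pair_det_simps)
  also have "\<dots> = ?s \<cdot> \<langle>yv k, \<langle>?J, \<langle>xv k, law z\<rangle>\<rangle>\<rangle> \<cdot> p"
    by (simp only: gen)
  also have "\<dots> = \<langle>law (XY_factors (Suc k)), law z\<rangle> \<cdot> p"
    using ty by (simp add: pair_simps pair_det_simps)
  finally show ?case .
qed

lemma local_imp_hidden_markov_form:
  assumes "local_markov C X Y n p"
  shows "hidden_markov_form C X Y n p"
proof -
  have f_ex: "\<exists>a. Dom C a = X t \<and> Cod C a = X (Suc t) \<and>
      \<langle>xv (Suc t), law (X_factors (Suc t))\<rangle> \<cdot> p = \<langle>a \<cdot> xv t, law (X_factors (Suc t))\<rangle> \<cdot> p"
    if t: "t < n" for t
  proof -
    have "ind {X_label (Suc t)} (X_label ` {..<t} \<union> Y_label ` {..<Suc t}) {X_label t}"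
      using assms t unfolding local_markov_iff by (force dest: bspec [of _ _ "Suc t"])
    then have "ind {X_label (Suc t)} (X_label ` {..<Suc t}) {X_label t}"
      by (rule ind_mono) (auto simp: lessThan_Suc)
    then have "generated p (xv (Suc t)) (law (X_factors (Suc t))) (xv t)"
      using t by (subst (asm) ind_iff_generated [of "Factor (X_label (Suc t))" _ "X_factors (Suc t)" _ _ "Factor (X_label t)"])
        (auto simp: lessThan_Suc)
    then show ?thesis
      using t by (simp add: generated_def hom_iff Bex_def)
  qed
  then obtain f' where f': "\<And>t. t < n \<Longrightarrow> Dom C (f' t) = X t \<and> Cod C (f' t) = X (Suc t) \<and>
      \<langle>xv (Suc t), law (X_factors (Suc t))\<rangle> \<cdot> p = \<langle>f' t \<cdot> xv t, law (X_factors (Suc t))\<rangle> \<cdot> p"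
    by metis
  \<comment> \<open>\<open>f'\<close> numbers a transition by its source time, \<open>f\<close> by
    its target time; index 0 is left for the marginal on \<open>X 0\<close>.\<close>
  define f where "f = case_nat (xv 0 \<cdot> p) f'"
  have f: "f 0 = xv 0 \<cdot> p" "\<And>t. t < n \<Longrightarrow> Dom C (f (Suc t)) = X t \<and> Cod C (f (Suc t)) = X (Suc t) \<and>
      \<langle>xv (Suc t), law (X_factors (Suc t))\<rangle> \<cdot> p = \<langle>f (Suc t) \<cdot> xv t, law (X_factors (Suc t))\<rangle> \<cdot> p"
    using f' by (auto simp: f_def)
  \<comment> \<open>A single kernel has to serve all spectators at once. It is chosen for the
    largest tuple \<open>K\<close>, with every label except \<open>Y t\<close>, and the equation is
    projected to the smaller ones.\<close>
  have g_ex: "\<exists>a. Dom C a = X t \<and> Cod C a = Y t \<and>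
      (\<forall>k. set_factors k \<subseteq> labels_before (Suc n) - {Y_label t} \<longrightarrow>
        \<langle>yv t, law k\<rangle> \<cdot> p = \<langle>a \<cdot> xv t, law k\<rangle> \<cdot> p)"
    if t: "t \<le> n" for t
  proof -
    let ?L = "labels_before (Suc n) - {Y_label t}"
    have "finite ?L" by (simp add: labels_before_def)
    from ex_factors [OF this] obtain K where K: "set_factors K = ?L" ..
    have "ind {Y_label t} (X_label ` ({..n} - {t}) \<union> Y_label ` ({..n} - {t})) {X_label t}"
      using assms t unfolding local_markov_iff by auto
    then have "ind {Y_label t} ?L {X_label t}"
      by (rule ind_mono) (auto simp: labels_before_def)
    moreover have "set_factors K = ?L \<union> {X_label t}" unfolding K using t by auto
    ultimately have "generated p (yv t) (law K) (xv t)"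
      using t ind_iff_generated [of "Factor (Y_label t)" "{Y_label t}" K ?L "{X_label t}" "Factor (X_label t)"]
      by simp
    then have "\<exists>a. Dom C a = X t \<and> Cod C a = Y t \<and> \<langle>yv t, law K\<rangle> \<cdot> p = \<langle>a \<cdot> xv t, law K\<rangle> \<cdot> p"
      using t by (simp add: generated_def hom_iff Bex_def)
    then obtain a where a: "Dom C a = X t" "Cod C a = Y t" "\<langle>yv t, law K\<rangle> \<cdot> p = \<langle>a \<cdot> xv t, law K\<rangle> \<cdot> p"
      by (elim exE conjE)
    have *: "\<langle>yv t, law k\<rangle> \<cdot> p = \<langle>a \<cdot> xv t, law k\<rangle> \<cdot> p" if k: "set_factors k \<subseteq> ?L" for k
    proof -
      have kK: "tuple F K k \<cdot> law K = law k"
        by (rule tuple_comp) (use k K set_all_factors in auto)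
      have sub: "set_factors k \<subseteq> set_factors K" "set_factors k \<subseteq> labels_before (Suc n)"
        "set_factors K \<subseteq> labels_before (Suc n)" using k K by auto
      have "\<langle>yv t, law k\<rangle> \<cdot> p = (Id C (Y t) \<boxtimes> tuple F K k) \<cdot> \<langle>yv t, law K\<rangle> \<cdot> p"
        using t sub kK by (simp add: pair_simps)
      also have "\<dots> = (Id C (Y t) \<boxtimes> tuple F K k) \<cdot> \<langle>a \<cdot> xv t, law K\<rangle> \<cdot> p"
        by (simp only: a(3))
      also have "\<dots> = \<langle>a \<cdot> xv t, law k\<rangle> \<cdot> p"
        using t sub kK a(1,2) by (simp add: pair_simps)
      finally show ?thesis .
    qed
    show ?thesis
      by (intro exI [of _ a] conjI allI impI a *)
  qed
  then obtain g where g: "\<And>t. t \<le> n \<Longrightarrow> Dom C (g t) = X t \<and> Cod C (g t) = Y t"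
      "\<And>t k. t \<le> n \<Longrightarrow> set_factors k \<subseteq> labels_before (Suc n) - {Y_label t} \<Longrightarrow>
        \<langle>yv t, law k\<rangle> \<cdot> p = \<langle>g t \<cdot> xv t, law k\<rangle> \<cdot> p"
    by metis
  let ?M = "emissions g (Suc n)" and ?K = "law (X_factors (Suc n))" and ?J = "law (XY_factors (Suc n))"
  have M: "Dom C ?M = obj C F (X_factors (Suc n))" "Cod C ?M = obj C F (XY_factors (Suc n))"
    using Dom_Cod_emissions [of "Suc n" g] g by auto
  have sub: "X_label ` {..<Suc n} \<subseteq> labels_before (Suc n)" by (auto simp: labels_before_def)
  then have K: "Dom C ?K = Cod C p" "Cod C ?K = obj C F (X_factors (Suc n))"
    by (simp_all del: X_factors_simps)
  have J: "?J = Id C (Cod C p)"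
    using tuple_self [OF distinct_all_factors, of F n] unfolding Cod_p all_factors_eq .
  have Cp: "Cod C p = obj C F (XY_factors (Suc n))"
    by (simp only: Cod_p all_factors_eq)
  \<comment> \<open>After the last emission no hidden variable is needed any more, so the spectator
    is trivial and \<open>pr1\<close> discards it.\<close>
  have eq: "\<langle>?M \<cdot> ?K, law Unit\<rangle> \<cdot> p = \<langle>?J, law Unit\<rangle> \<cdot> p"
    by (rule emissions_law [OF g]) auto
  have "?M \<cdot> chain C X f n = ?M \<cdot> ?K \<cdot> p"
    using chain_eq_law [OF f, of n] by simp
  also have "\<dots> = pr1 (Cod C p) \<I> \<cdot> \<langle>?M \<cdot> ?K, law Unit\<rangle> \<cdot> p"
    using M K Cp by (simp add: pair_simps all_factors_eq del: X_factors_simps XY_factors_simps)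
  also have "\<dots> = pr1 (Cod C p) \<I> \<cdot> \<langle>?J, law Unit\<rangle> \<cdot> p"
    by (simp only: eq)
  also have "\<dots> = p"
    unfolding J by (simp add: pair_simps Cod_p)
  finally have "p = ?M \<cdot> chain C X f n" ..
  moreover have "Dom C (f 0) = \<I>" "Cod C (f 0) = X 0"
    by (simp_all add: f(1) Dom_p)
  ultimately show ?thesis
    unfolding hidden_markov_form_iff
    by (intro exI [of _ f] exI [of _ g] conjI allI impI) (assumption | simp add: f(2) g(1))+
qed

text \<open>Reading the hidden coordinate \<open>B\<close> after the emissions returns the value
  they received, jointly with all their outputs. Since \<open>m\<close> and \<open>h\<close> are
  random, the reading is rewritten as \<open>?r\<close>, which copies nothing but the retained
  coordinate \<open>B\<close>.\<close>

lemma pr1_pr2_pair_tensor: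
  assumes "Dom C h = B"
  shows "\<langle>pr1 B (Cod C h) \<cdot> pr2 (Cod C m) (B \<otimes> Cod C h), Id C (Cod C m \<otimes> (B \<otimes> Cod C h))\<rangle> \<cdot> (m \<boxtimes> \<langle>Id C B, h\<rangle>)
    = \<langle>pr2 (Dom C m) B, m \<boxtimes> \<langle>Id C B, h\<rangle>\<rangle>"
proof -
  let ?A = "Cod C m" and ?D = "Cod C h"
  let ?r = "assoc C B ?A (B \<otimes> ?D) \<cdot> (swap C ?A B \<boxtimes> Id C (B \<otimes> ?D)) \<cdot> assoc' C ?A B (B \<otimes> ?D)
    \<cdot> (Id C ?A \<boxtimes> (assoc C B B ?D \<cdot> (copy C B \<boxtimes> Id C ?D)))"
  have r: "?r \<cdot> \<langle>a, \<langle>b, d\<rangle>\<rangle> = \<langle>b, \<langle>a, \<langle>b, d\<rangle>\<rangle>\<rangle>"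
    if "det b" "Cod C a = ?A" "Cod C b = B" "Cod C d = ?D" "Dom C a = Dom C d" "Dom C b = Dom C d" for a b d
    using that by (simp add: pair_simps copy_comp_det)
  have 1: "\<langle>pr1 B ?D \<cdot> pr2 ?A (B \<otimes> ?D), Id C (?A \<otimes> (B \<otimes> ?D))\<rangle> = ?r"
    using r [of "pr1 B ?D \<cdot> pr2 ?A (B \<otimes> ?D)" "pr1 ?A (B \<otimes> ?D)" "pr2 B ?D \<cdot> pr2 ?A (B \<otimes> ?D)"]
    by (simp add: triple_pr')
  have 2: "m \<boxtimes> \<langle>Id C B, h\<rangle> = \<langle>m \<cdot> pr1 (Dom C m) B, \<langle>pr2 (Dom C m) B, h \<cdot> pr2 (Dom C m) B\<rangle>\<rangle>"
    using assms by (simp add: tensor_eq_pair pair_comp_det)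
  show ?thesis
    unfolding 1 2 using assms by (intro r) simp_all
qed

section \<open>Independences read off from a hidden Markov form\<close>

context
  fixes f g
  assumes f0: "Dom C (f 0) = \<I>" "Cod C (f 0) = X 0"
    and f: "\<And>t. t < n \<Longrightarrow> Dom C (f (Suc t)) = X t" "\<And>t. t < n \<Longrightarrow> Cod C (f (Suc t)) = X (Suc t)"
    and g: "\<And>t. t \<le> n \<Longrightarrow> Dom C (g t) = X t" "\<And>t. t \<le> n \<Longrightarrow> Cod C (g t) = Y t"
    and p_eq: "p = emissions g (Suc n) \<cdot> chain C X f n"
begin

lemma emissions_typed [simp]:
  assumes "t \<le> Suc n"
  shows "Dom C (emissions g t) = obj C F (X_factors t)" "Cod C (emissions g t) = obj C F (XY_factors t)"
  by (rule Dom_Cod_emissions; use assms g in simp)+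

lemma chain_typed [simp]:
  assumes "t \<le> n"
  shows "Dom C (chain C X f t) = \<I>" "Cod C (chain C X f t) = obj C F (X_factors (Suc t))"
proof -
  have "Dom C (chain C X f t) = \<I> \<and> Cod C (chain C X f t) = obj C F (X_factors (Suc t))"
    using assms
  proof (induction t)
    case 0
    then show ?case by (simp add: f0)
  next
    case (Suc t)
    then show ?case using f by (simp add: chain_Suc_pair del: chain.simps)
  qed
  then show "Dom C (chain C X f t) = \<I>" "Cod C (chain C X f t) = obj C F (X_factors (Suc t))"
    by auto
qed

lemma chain_Suc_extend:
  assumes "t < n"
  shows "chain C X f (Suc t) =
    \<langle>Id C (obj C F (X_factors (Suc t))), f (Suc t) \<cdot> pr2 (obj C F (X_factors t)) (X t)\<rangle> \<cdot> chain C X f t"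
proof -
  let ?O = "obj C F (X_factors t)"
  have "assoc' C ?O (X t) (X (Suc t)) \<cdot> (Id C ?O \<boxtimes> \<langle>Id C (X t), f (Suc t)\<rangle>)
      = \<langle>Id C (?O \<otimes> X t), f (Suc t) \<cdot> pr2 ?O (X t)\<rangle>"
    using f assms by (simp add: tensor_eq_pair pair_simps pair_det_simps)
  then show ?thesis
    using f assms by (simp add: chain_Suc_pair del: chain.simps flip: comp_assoc)
qed

text \<open>Downward induction from \<open>n\<close>, where the equation is the form itself:
  discarding the last pair deletes its emission and then the transition that produced its hidden
  variable.\<close>

lemma law_prefix:
  assumes "t \<le> n"
  shows "law (XY_factors (Suc t)) \<cdot> p = emissions g (Suc t) \<cdot> chain C X f t"
  using assms
proof (induction rule: inc_induct)
  case base
  have "law (XY_factors (Suc n)) = Id C (Cod C p)"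
    using tuple_self [OF distinct_all_factors, of F n] unfolding Cod_p all_factors_eq .
  then show ?case using p_eq by simp
next
  case (step t)
  let ?J = "XY_factors (Suc t)" and ?D = "X (Suc t) \<otimes> Y (Suc t)" and ?M = "emissions g (Suc t)" and ?c = "chain C X f t"
  have tn: "t < n" by fact
  have sub: "labels_before (Suc (Suc t)) \<subseteq> labels_before (Suc n)" "labels_before (Suc t) \<subseteq> labels_before (Suc n)"
    using tn by (auto simp: labels_before_def)
  have "law ?J \<cdot> p = pr1 (obj C F ?J) ?D \<cdot> law (XY_factors (Suc (Suc t))) \<cdot> p"
    using tn sub by (subst XY_factors_simps(2) [of "Suc t"]) (simp add: pair_simps del: XY_factors_simps)
  also have "\<dots> = pr1 (obj C F ?J) ?D \<cdot> emissions g (Suc (Suc t)) \<cdot> chain C X f (Suc t)"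
    by (simp only: step.IH)
  also have "\<dots> = (pr1 (obj C F ?J) ?D \<cdot> (?M \<boxtimes> \<langle>Id C (X (Suc t)), g (Suc t)\<rangle>)) \<cdot> chain C X f (Suc t)"
    using tn g by (subst emissions_Suc) (simp_all del: XY_factors_simps X_factors_simps chain.simps add: X_factors_simps(2) [of "Suc t"])
  also have "\<dots> = ?M \<cdot> pr1 (obj C F (X_factors (Suc t))) (X (Suc t)) \<cdot> chain C X f (Suc t)"
    using tn g by (subst pr1_tensor) (simp_all del: XY_factors_simps X_factors_simps chain.simps add: X_factors_simps(2) [of "Suc t"])
  also have "\<dots> = ?M \<cdot> ?c"
    using tn f by (simp add: chain_Suc_extend pair_simps del: chain.simps)
  finally show ?case .
qed

text \<open>In the prefix longer by one pair, \<open>f (Suc t)\<close> is fed by the value of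
  \<open>X t\<close> before the emissions. \<open>pr1_pr2_pair_tensor\<close> moves this reading
  behind them, where \<open>X t\<close> is the variable \<open>xv t\<close> of the sample
  space.\<close>

lemma generated_X:
  assumes t: "t < n"
  shows "generated p (xv (Suc t)) (law (XY_factors (Suc t))) (xv t)"
proof (rule generatedI [of "f (Suc t)"])
  let ?J = "XY_factors (Suc t)" and ?D = "X (Suc t) \<otimes> Y (Suc t)" and ?M = "emissions g (Suc t)" and ?c = "chain C X f t"
  let ?P = "obj C F (XY_factors t)" and ?O = "obj C F (X_factors t)" and ?J' = "obj C F (XY_factors (Suc t))"
  have sub: "labels_before t \<subseteq> labels_before (Suc n)" "labels_before (Suc t) \<subseteq> labels_before (Suc n)"
    using t by (auto simp: labels_before_def)
  have M: "?M = emissions g t \<boxtimes> \<langle>Id C (X t), g t\<rangle>"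
    using t g by (simp add: emissions_Suc)
  let ?s = "swap C ?J' (X (Suc t)) \<cdot> (Id C ?J' \<boxtimes> pr1 (X (Suc t)) (Y (Suc t)))"
  have "\<langle>xv (Suc t), law ?J\<rangle> \<cdot> p = ?s \<cdot> law (XY_factors (Suc (Suc t))) \<cdot> p"
    using t sub by (subst XY_factors_simps(2) [of "Suc t"]) (simp add: pair_simps del: XY_factors_simps)
  also have "\<dots> = ?s \<cdot> emissions g (Suc (Suc t)) \<cdot> chain C X f (Suc t)"
    using t by (subst law_prefix) simp_all
  also have "\<dots> = ?s \<cdot> (?M \<boxtimes> \<langle>Id C (X (Suc t)), g (Suc t)\<rangle>)
      \<cdot> \<langle>Id C (?O \<otimes> X t), f (Suc t) \<cdot> pr2 ?O (X t)\<rangle> \<cdot> ?c"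
    using t g by (subst emissions_Suc) (simp_all add: chain_Suc_extend del: chain.simps)
  also have "\<dots> = \<langle>f (Suc t) \<cdot> pr2 ?O (X t), ?M\<rangle> \<cdot> ?c"
    using t g f by (simp add: pair_simps)
  also have "\<dots> = (f (Suc t) \<boxtimes> Id C ?J') \<cdot> \<langle>pr2 ?O (X t), ?M\<rangle> \<cdot> ?c"
    using t g f by (simp add: pair_simps)
  also have "\<langle>pr2 ?O (X t), ?M\<rangle> = \<langle>pr1 (X t) (Y t) \<cdot> pr2 ?P (X t \<otimes> Y t), Id C ?J'\<rangle> \<cdot> ?M"
    using pr1_pr2_pair_tensor [of "g t" "X t" "emissions g t"] t g unfolding M by simp
  also have "(f (Suc t) \<boxtimes> Id C ?J') \<cdot> (\<langle>pr1 (X t) (Y t) \<cdot> pr2 ?P (X t \<otimes> Y t), Id C ?J'\<rangle> \<cdot> ?M) \<cdot> ?c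
      = (f (Suc t) \<boxtimes> Id C ?J') \<cdot> \<langle>pr1 (X t) (Y t) \<cdot> pr2 ?P (X t \<otimes> Y t), Id C ?J'\<rangle> \<cdot> law ?J \<cdot> p"
    using t law_prefix [of t] by (simp del: tuple.simps)
  also have "\<dots> = \<langle>f (Suc t) \<cdot> xv t, law ?J\<rangle> \<cdot> p"
    using t f sub by (simp add: pair_simps pair_det_simps)
  finally show "\<langle>xv (Suc t), law ?J\<rangle> \<cdot> p = \<langle>f (Suc t) \<cdot> xv t, law ?J\<rangle> \<cdot> p" .
qed (use t f in simp_all)

lemma generated_Y:
  assumes t: "t \<le> n"
  shows "generated p (yv t) \<langle>law (XY_factors t), xv t\<rangle> (xv t)"
proof (rule generatedI [of "g t"])
  let ?J = "XY_factors t" and ?M = "emissions g t" and ?c = "chain C X f t"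
  let ?P = "obj C F (XY_factors t)" and ?O = "obj C F (X_factors t)"
  have sub: "labels_before t \<subseteq> labels_before (Suc n)" using t by (auto simp: labels_before_def)
  have M: "emissions g (Suc t) = \<langle>?M \<cdot> pr1 ?O (X t), \<langle>pr2 ?O (X t), g t \<cdot> pr2 ?O (X t)\<rangle>\<rangle>"
    using t g by (simp add: emissions_Suc tensor_eq_pair pair_det_simps)
  \<comment> \<open>\<open>?e\<close> is the stage at which all earlier emissions are done and
    \<open>X t\<close> has not emitted yet; \<open>?r\<close> performs its emission from a copy and
    moves the result to the front.\<close>
  let ?e = "\<langle>?M \<cdot> pr1 ?O (X t), pr2 ?O (X t)\<rangle>"
  let ?s = "swap C (?P \<otimes> X t) (Y t) \<cdot> assoc' C ?P (X t) (Y t)"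
  let ?r = "assoc C (Y t) ?P (X t) \<cdot> (swap C ?P (Y t) \<boxtimes> Id C (X t)) \<cdot> assoc' C ?P (Y t) (X t) \<cdot> (Id C ?P \<boxtimes> \<langle>g t, Id C (X t)\<rangle>)"
  have "\<langle>law ?J, xv t\<rangle> \<cdot> p = (Id C ?P \<boxtimes> pr1 (X t) (Y t)) \<cdot> law (XY_factors (Suc t)) \<cdot> p"
    using t sub by (simp add: pair_simps)
  also have "\<dots> = (Id C ?P \<boxtimes> pr1 (X t) (Y t)) \<cdot> emissions g (Suc t) \<cdot> ?c"
    using t by (subst law_prefix) simp_all
  also have "\<dots> = ?e \<cdot> ?c"
    using t g by (simp add: M pair_simps)
  finally have e: "\<langle>law ?J, xv t\<rangle> \<cdot> p = ?e \<cdot> ?c" .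
  have "\<langle>yv t, \<langle>law ?J, xv t\<rangle>\<rangle> \<cdot> p = ?s \<cdot> law (XY_factors (Suc t)) \<cdot> p"
    using t sub by (simp add: pair_simps)
  also have "\<dots> = ?s \<cdot> emissions g (Suc t) \<cdot> ?c"
    using t by (subst law_prefix) simp_all
  also have "\<dots> = ?r \<cdot> ?e \<cdot> ?c"
    using t g by (simp add: M pair_simps pair_det_simps)
  also have "\<dots> = ?r \<cdot> \<langle>law ?J, xv t\<rangle> \<cdot> p"
    by (simp only: e)
  also have "\<dots> = \<langle>g t \<cdot> xv t, \<langle>law ?J, xv t\<rangle>\<rangle> \<cdot> p"
    using t g sub by (simp add: pair_simps pair_det_simps)
  finally show "\<langle>yv t, \<langle>law ?J, xv t\<rangle>\<rangle> \<cdot> p = \<langle>g t \<cdot> xv t, \<langle>law ?J, xv t\<rangle>\<rangle> \<cdot> p" .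
qed (use t g in simp_all)

lemma hidden_markov_form_backward: "backward_markov C X Y n p"
  unfolding backward_markov_iff
proof (intro conjI ballI)
  fix t
  assume "t \<in> {1..n}"
  then obtain s where s: "t = Suc s" "s < n" by (cases t) auto
  have "ind {X_label (Suc s)} (labels_before (Suc s)) {X_label s}"
    using generated_X [OF s(2)] s(2)
    by (subst ind_iff_generated [of "Factor (X_label (Suc s))" _ "XY_factors (Suc s)" _ _ "Factor (X_label s)"])
      (auto simp: labels_before_def)
  then show "ind {X_label t} (X_label ` {..<t - 1} \<union> Y_label ` {..<t}) {X_label (t - 1)}"
    unfolding s(1) by (rule ind_mono) (auto simp: labels_before_def)
next
  fix t
  assume t: "t \<in> {1..n}"
  then have "ind {Y_label t} (labels_before t) {X_label t}"
    using generated_Y [of t]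
    by (subst ind_iff_generated [of "Factor (Y_label t)" _ "Tens (XY_factors t) (Factor (X_label t))" _ _ "Factor (X_label t)"])
      (auto simp: labels_before_def)
  then show "ind {Y_label t} (Y_label ` {..<t} \<union> X_label ` {..<t}) {X_label t}"
    by (simp add: labels_before_def Un_commute)
qed

end

lemma hidden_markov_form_imp_backward:
  assumes "hidden_markov_form C X Y n p"
  shows "backward_markov C X Y n p"
proof -
  obtain f g where "Dom C (f 0) = \<I>" "Cod C (f 0) = X 0"
    "\<And>t. t < n \<Longrightarrow> Dom C (f (Suc t)) = X t" "\<And>t. t < n \<Longrightarrow> Cod C (f (Suc t)) = X (Suc t)"
    "\<And>t. t \<le> n \<Longrightarrow> Dom C (g t) = X t" "\<And>t. t \<le> n \<Longrightarrow> Cod C (g t) = Y t"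
    "p = emissions g (Suc n) \<cdot> chain C X f n"
    using assms unfolding hidden_markov_form_iff by blast
  then show ?thesis by (rule hidden_markov_form_backward)
qed

end

theorem proposition3p7:
  fixes C :: "('o, 'm) markov_data"
    and X Y :: "nat \<Rightarrow> 'o"
    and n :: nat
    and p :: 'm
  assumes "markov_category C"
    and "has_conditionals C"
    and "p \<in> hom C \<I>\<^bsub>C\<^esub> (obj_list C (map (\<lambda>t. X t \<otimes>\<^bsub>C\<^esub> Y t) [0..<Suc n]))"
  shows "(backward_markov C X Y n p \<longleftrightarrow> local_markov C X Y n p)
    \<and> (local_markov C X Y n p \<longleftrightarrow> global_markov C X Y n p)
    \<and> (global_markov C X Y n p \<longleftrightarrow> hidden_markov_form C X Y n p)"
proof -
  interpret markov_category C by fact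
  have F: "obj_list C (map (\<lambda>t. X t \<otimes>\<^bsub>C\<^esub> Y t) [0..<Suc n]) = obj C (case_label X Y) (all_factors n)"
    by (simp only: obj_XY_factors all_factors_eq)
  interpret hidden_markov_state C X Y n p
    using assms(2,3) unfolding F hom_iff by unfold_locales auto
  show ?thesis
    using local_imp_backward backward_imp_global global_imp_local
      local_imp_hidden_markov_form hidden_markov_form_imp_backward by blast
qed

end
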